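(* Let $E$ be a finite set and let $f_0,f_1,\dots,f_k\colon\mathbb{Z}^E\to\mathbb{R}\cup\{\infty\}$ be M-convex functions such that for every $i\in\{1,\dots,k\}$ one has $\mathrm{rk}(f_i)=\mathrm{rk}(f_{i-1})+1$ and the pair $(f,g)=(f_i,f_{i-1})$ satisfies any one of the (in this case equivalent) conditions (A), (B), (C), (D) listed in the context. Assume moreover that $P=\bigcup_{i=0}^k\mathrm{dom}(f_i)$ is an M$^\natural$-convex set. Then there exist constants $c_0,c_1,\dots,c_k\in\mathbb{R}$ such that $f_0-c_0,\,f_1-c_1,\dots,f_k-c_k$ are the layers of the M$^\natural$-convex function $$h(x)=\inf\big(f_0(x)-c_0,\dots,f_k(x)-c_k\big).$$
   Context: Notation: $x(A)=\sum_{i\in A}x_i$; $e_i$ unit vectors; $\mathrm{supp}^+(x-y)=\{i:x_i>y_i\}$, $\mathrm{supp}^-(x-y)=\mathrm{supp}^+(y-x)$. M$^\natural$-convex functions: $f\colon\mathbb{Z}^E\to\mathbb{R}\cup\{\infty\}$ with $\mathrm{dom}(f)=\{x:f(x)<\infty\}$ non-empty and bounded such that (i) for all $x,y\in\mathrm{dom}(f)$ with $x(E)>y(E)$: $f(x)+f(y)\ge\min_{j\in\mathrm{supp}^+(x-y)}(f(x-e_j)+f(y+e_j))$; (ii) for all $x,y\in\mathrm{dom}(f)$ with $x(E)=y(E)$ and all $i\in\mathrm{supp}^+(x-y)$: $f(x)+f(y)\ge\min_{j\in\mathrm{supp}^-(x-y)}(f(x-e_i+e_j)+f(y+e_i-e_j))$.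 A bounded non-empty set $P\subseteq\mathbb{Z}^E$ is M$^\natural$-convex if for all $x,y\in P$: if $x(E)>y(E)$ there is $i\in\mathrm{supp}^+(x-y)$ with $x-e_i,\,y+e_i\in P$; if $x(E)=y(E)$, for all $i\in\mathrm{supp}^+(x-y)$ there is $j\in\mathrm{supp}^-(x-y)$ with $x-e_i+e_j,\ y+e_i-e_j\in P$ (equivalently, the function that is $0$ on $P$ and $\infty$ elsewhere is M$^\natural$-convex). A layer of an M$^\natural$-convex function $h$ is the function equal to $h$ on a non-empty set $\mathrm{dom}(h)\cap\{x:x(E)=k\}$ and $\infty$ elsewhere; $h^\uparrow$, $h^\downarrow$ denote the layers with maximal and minimal $k$. An M-convex function is a layer of an M$^\natural$-convex function; equivalently its (non-empty, bounded) domain lies in some hyperplane $x(E)=k$ and (ii) holds; its rank is $\mathrm{rk}(f)=k$. Conditions for a pair $(f,g)$ of M-convex functions on $\mathbb{Z}^E$: (A) There is an M$^\natural$-convex function $h$ on $\mathbb{Z}^E$ with $h^\uparrow=f$ and $h^\downarrow=g$. (B) There are a finite set $\widetilde E$ and M-convex functions $\gamma\colon\mathbb{Z}^E\times\mathbb{Z}^{\widetilde E}\to\mathbb{R}\cup\{\infty\}$, $r\colon\mathbb{Z}^{\widetilde E}\to\mathbb{R}\cup\{\infty\}$ such that $f=\pi_E(\gamma)^\uparrow$, where $\pi_E(\gamma)(x)=\inf_{y}\gamma(x,y)$, and $g(x)=\inf_{y\in\mathbb{Z}^{\widetilde E}}(\gamma(x,-y)+r(y))$ for all $x$. (C) For every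 $x\in\mathrm{dom}(f)$, $y\in\mathrm{dom}(g)$, $i\in\mathrm{supp}^+(y-x)$ there is $j\in\mathrm{supp}^-(y-x)$ with $f(x)+g(y)\ge f(x+e_i-e_j)+g(y-e_i+e_j)$. (D) For every $u\in(\mathbb{R}^E)^*$, with $f^u=\mathrm{argmin}_x(f(x)-\langle u,x\rangle)$ and $g^u$ analogous, and $p(A)=\max_{x\in f^u}x(A)$, $q(A)=\max_{x\in g^u}x(A)$, one has $q(Y)-q(X)\le p(Y)-p(X)$ for all $X\subseteq Y\subseteq E$. *)

theory Defs
  imports "HOL-Library.Extended_Real" "HOL-Library.Function_Algebras"
begin

text \<open>
  The lattice \<open>\<int>\<^sup>E\<close> for \<open>E :: 'a set\<close> is the set of integer vectors \<open>'a \<Rightarrow> int\<close> that vanish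
  outside \<open>E\<close>. A function \<open>\<int>\<^sup>E \<rightarrow> \<real> \<union> {\<infinity>}\<close> is a function into \<open>ereal\<close> that never takes the
  value \<open>-\<infinity>\<close> and is \<open>\<infinity>\<close> outside \<open>\<int>\<^sup>E\<close>; both requirements are part of \<open>Mnat_convex\<close>.
\<close>

definition lattice_vecs :: "'a set \<Rightarrow> ('a \<Rightarrow> int) set" where
  "lattice_vecs E = {x. \<forall>i. i \<notin> E \<longrightarrow> x i = 0}"

definition unit_vec :: "'a \<Rightarrow> 'a \<Rightarrow> int" where
  "unit_vec i = (\<lambda>j. if j = i then 1 else 0)"

definition coord_sum :: "'a set \<Rightarrow> ('a \<Rightarrow> int) \<Rightarrow> int" where
  "coord_sum A x = (\<Sum>i\<in>A. x i)"

text \<open>\<open>supp_pos E x y\<close> is \<open>supp\<^sup>+(x - y)\<close>, and \<open>supp_neg E x y\<close> is \<open>supp\<^sup>-(x - y)\<close>.\<close>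

definition supp_pos :: "'a set \<Rightarrow> ('a \<Rightarrow> int) \<Rightarrow> ('a \<Rightarrow> int) \<Rightarrow> 'a set" where
  "supp_pos E x y = {i \<in> E. x i > y i}"

definition supp_neg :: "'a set \<Rightarrow> ('a \<Rightarrow> int) \<Rightarrow> ('a \<Rightarrow> int) \<Rightarrow> 'a set" where
  "supp_neg E x y = supp_pos E y x"

definition eff_dom :: "(('a \<Rightarrow> int) \<Rightarrow> ereal) \<Rightarrow> ('a \<Rightarrow> int) set" where
  "eff_dom f = {x. f x < \<infinity>}"

definition bounded_vecs :: "'a set \<Rightarrow> ('a \<Rightarrow> int) set \<Rightarrow> bool" where
  "bounded_vecs E P \<longleftrightarrow> (\<exists>B. \<forall>x\<in>P. \<forall>i\<in>E. \<bar>x i\<bar> \<le> B)"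

text \<open>
  For finite \<open>E\<close> the minima below range over finite non-empty sets: if \<open>x(E) > y(E)\<close>, or if
  \<open>x(E) = y(E)\<close> and \<open>supp\<^sup>+(x - y)\<close> is non-empty, then the support in question is non-empty.
\<close>

definition Mnat_convex :: "'a set \<Rightarrow> (('a \<Rightarrow> int) \<Rightarrow> ereal) \<Rightarrow> bool" where
  "Mnat_convex E f \<longleftrightarrow>
     (\<forall>x. f x \<noteq> -\<infinity>) \<and> eff_dom f \<subseteq> lattice_vecs E \<and>
     eff_dom f \<noteq> {} \<and> bounded_vecs E (eff_dom f) \<and>
     (\<forall>x\<in>eff_dom f. \<forall>y\<in>eff_dom f. coord_sum E x > coord_sum E y \<longrightarrow>
        f x + f y \<ge> Min ((\<lambda>j. f (x - unit_vec j) + f (y + unit_vec j)) ` supp_pos E x y)) \<and>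
     (\<forall>x\<in>eff_dom f. \<forall>y\<in>eff_dom f. coord_sum E x = coord_sum E y \<longrightarrow>
        (\<forall>i\<in>supp_pos E x y.
           f x + f y \<ge> Min ((\<lambda>j. f (x - unit_vec i + unit_vec j) + f (y + unit_vec i - unit_vec j))
                              ` supp_neg E x y)))"

definition Mnat_convex_set :: "'a set \<Rightarrow> ('a \<Rightarrow> int) set \<Rightarrow> bool" where
  "Mnat_convex_set E P \<longleftrightarrow>
     P \<subseteq> lattice_vecs E \<and> P \<noteq> {} \<and> bounded_vecs E P \<and>
     (\<forall>x\<in>P. \<forall>y\<in>P. coord_sum E x > coord_sum E y \<longrightarrow>
        (\<exists>i\<in>supp_pos E x y. x - unit_vec i \<in> P \<and> y + unit_vec i \<in> P)) \<and>
     (\<forall>x\<in>P. \<forall>y\<in>P. coord_sum E x = coord_sum E y \<longrightarrow>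
        (\<forall>i\<in>supp_pos E x y. \<exists>j\<in>supp_neg E x y.
           x - unit_vec i + unit_vec j \<in> P \<and> y + unit_vec i - unit_vec j \<in> P))"

definition layer_at :: "'a set \<Rightarrow> (('a \<Rightarrow> int) \<Rightarrow> ereal) \<Rightarrow> int \<Rightarrow> ('a \<Rightarrow> int) \<Rightarrow> ereal" where
  "layer_at E h k = (\<lambda>x. if coord_sum E x = k then h x else \<infinity>)"

definition layers :: "'a set \<Rightarrow> (('a \<Rightarrow> int) \<Rightarrow> ereal) \<Rightarrow> (('a \<Rightarrow> int) \<Rightarrow> ereal) set" where
  "layers E h = layer_at E h ` coord_sum E ` eff_dom h"

definition top_layer :: "'a set \<Rightarrow> (('a \<Rightarrow> int) \<Rightarrow> ereal) \<Rightarrow> ('a \<Rightarrow> int) \<Rightarrow> ereal" where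
  "top_layer E h = layer_at E h (Max (coord_sum E ` eff_dom h))"

definition bottom_layer :: "'a set \<Rightarrow> (('a \<Rightarrow> int) \<Rightarrow> ereal) \<Rightarrow> ('a \<Rightarrow> int) \<Rightarrow> ereal" where
  "bottom_layer E h = layer_at E h (Min (coord_sum E ` eff_dom h))"

definition M_convex :: "'a set \<Rightarrow> (('a \<Rightarrow> int) \<Rightarrow> ereal) \<Rightarrow> bool" where
  "M_convex E f \<longleftrightarrow> (\<exists>h. Mnat_convex E h \<and> f \<in> layers E h)"

definition rk :: "'a set \<Rightarrow> (('a \<Rightarrow> int) \<Rightarrow> ereal) \<Rightarrow> int" where
  "rk E f = (THE k. \<forall>x\<in>eff_dom f. coord_sum E x = k)"

definition cond_A ::
  "'a set \<Rightarrow> (('a \<Rightarrow> int) \<Rightarrow> ereal) \<Rightarrow> (('a \<Rightarrow> int) \<Rightarrow> ereal) \<Rightarrow> bool" where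
  "cond_A E f g \<longleftrightarrow> (\<exists>h. Mnat_convex E h \<and> top_layer E h = f \<and> bottom_layer E h = g)"

text \<open>
  \<open>\<int>\<^sup>E \<times> \<int>\<^sup>E'\<close> is identified with \<open>\<int>\<^bsup>E <+> E'\<^esup>\<close>, the pair \<open>(x, y)\<close> being \<open>case_sum x y\<close>.
\<close>

definition projection ::
  "'b set \<Rightarrow> (('a + 'b \<Rightarrow> int) \<Rightarrow> ereal) \<Rightarrow> ('a \<Rightarrow> int) \<Rightarrow> ereal" where
  "projection E' \<gamma> = (\<lambda>x. INF y\<in>lattice_vecs E'. \<gamma> (case_sum x y))"

text \<open>
  The auxiliary finite set is taken inside \<open>nat\<close>; since every finite set is in bijection with
  a set of natural numbers, this loses no generality.
\<close>

definition cond_B ::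
  "'a set \<Rightarrow> (('a \<Rightarrow> int) \<Rightarrow> ereal) \<Rightarrow> (('a \<Rightarrow> int) \<Rightarrow> ereal) \<Rightarrow> bool" where
  "cond_B E f g \<longleftrightarrow>
     (\<exists>(E' :: nat set) \<gamma> r. finite E' \<and> M_convex (E <+> E') \<gamma> \<and> M_convex E' r \<and>
        f = top_layer E (projection E' \<gamma>) \<and>
        (\<forall>x\<in>lattice_vecs E. g x = (INF y\<in>lattice_vecs E'. \<gamma> (case_sum x (- y)) + r y)))"

definition cond_C ::
  "'a set \<Rightarrow> (('a \<Rightarrow> int) \<Rightarrow> ereal) \<Rightarrow> (('a \<Rightarrow> int) \<Rightarrow> ereal) \<Rightarrow> bool" where
  "cond_C E f g \<longleftrightarrow>
     (\<forall>x\<in>eff_dom f. \<forall>y\<in>eff_dom g. \<forall>i\<in>supp_pos E y x. \<exists>j\<in>supp_neg E y x.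
        f x + g y \<ge> f (x + unit_vec i - unit_vec j) + g (y - unit_vec i + unit_vec j))"

text \<open>A linear form on \<open>\<real>\<^sup>E\<close> is given by its coefficients \<open>u i\<close> for \<open>i \<in> E\<close>.\<close>

definition pairing :: "'a set \<Rightarrow> ('a \<Rightarrow> real) \<Rightarrow> ('a \<Rightarrow> int) \<Rightarrow> real" where
  "pairing E u x = (\<Sum>i\<in>E. u i * real_of_int (x i))"

definition minimizers ::
  "'a set \<Rightarrow> (('a \<Rightarrow> int) \<Rightarrow> ereal) \<Rightarrow> ('a \<Rightarrow> real) \<Rightarrow> ('a \<Rightarrow> int) set" where
  "minimizers E f u =
     {x. is_arg_min (\<lambda>x. f x - ereal (pairing E u x)) (\<lambda>x. x \<in> lattice_vecs E) x}"

definition max_coord_sum :: "('a \<Rightarrow> int) set \<Rightarrow> 'a set \<Rightarrow> int" where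
  "max_coord_sum P A = Max (coord_sum A ` P)"

definition cond_D ::
  "'a set \<Rightarrow> (('a \<Rightarrow> int) \<Rightarrow> ereal) \<Rightarrow> (('a \<Rightarrow> int) \<Rightarrow> ereal) \<Rightarrow> bool" where
  "cond_D E f g \<longleftrightarrow>
     (\<forall>u :: 'a \<Rightarrow> real. \<forall>X Y. X \<subseteq> Y \<and> Y \<subseteq> E \<longrightarrow>
        max_coord_sum (minimizers E g u) Y - max_coord_sum (minimizers E g u) X
          \<le> max_coord_sum (minimizers E f u) Y - max_coord_sum (minimizers E f u) X)"

end

theory Submission
  imports Defs
begin

text \<open>
The constants are \<open>c\<^sub>i = - M i\<^sup>2\<close> for a large \<open>M\<close>. The exchange property of \<open>h\<close> for two points then
depends on the distance of their layers.

\<^item> For points in the same layer it is the M-convexity of \<open>f\<^sub>i\<close>.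

\<^item> For points at least two layers apart, the M\<open>\<^sup>\<natural>\<close>-convexity of the union \<open>P\<close> of the domains supplies an
exchange inside \<open>P\<close>. It brings the layers closer together, and by the convexity of \<open>M i\<^sup>2\<close> this
outweighs any change of the values of the functions.

\<^item> For points in adjacent layers the constants cancel, and the property (\<open>adjacent_exchange\<close>) has to
come from the conditions (A) to (D) on the pair \<open>(f\<^sub>i, f\<^sub>i\<^sub>-\<^sub>1)\<close>.

Condition (A) contains the adjacent exchange. From the other conditions the special case
\<open>x = w + e\<^sub>a + e\<^sub>b\<close>, \<open>y = w + e\<^sub>c\<close> is derived (\<open>local_exchange\<close>); on the M\<open>\<^sup>\<natural>\<close>-convex set \<open>P\<close> it
implies all others (\<open>adjacent_exchange_if_local\<close>). Condition (C) states it almost literally, and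
(B) implies (C) by an exchange in \<open>\<gamma>\<close> (\<open>cond_C_if_cond_B\<close>).

The case of (D) is different, because (D) only speaks of global minimizers, while
the points of a local exchange need not minimize anything in common. Since the ranks differ by one, (D)
implies that, for every \<open>u\<close> and every minimizer \<open>y\<close> of \<open>f\<^sub>i\<^sub>-\<^sub>1 - u\<close>, some \<open>y + e\<^sub>j\<close> minimizes \<open>f\<^sub>i - u\<close>
(\<open>lifts_minimizers_if_cond_D\<close>). The key point is that this statement is inherited by the
restrictions of both functions to a half-space \<open>m \<le> x i\<close> (\<open>lifts_minimizers_cut\<close>). After the restriction
to all vectors above \<open>w\<close> only a few points remain, and a violated local exchange allows one to write down
a \<open>u\<close> for which the statement fails (\<open>local_exchange_if_lifts_minimizers\<close>).
\<close>

section \<open>Exchange on finite valued sets of lattice points\<close>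

text \<open>
An M-convex function is handled as the pair of its effective domain \<open>S\<close> and its real values \<open>\<phi>\<close>
there, so that linear forms can be subtracted without case distinctions at \<open>\<infinity>\<close>. Restricting the
function to a box then only changes \<open>S\<close>.
\<close>

definition M_exchange :: "('a \<Rightarrow> int) set \<Rightarrow> (('a \<Rightarrow> int) \<Rightarrow> real) \<Rightarrow> bool" where
  "M_exchange S \<phi> \<longleftrightarrow> (\<forall>x\<in>S. \<forall>y\<in>S. \<forall>i. y i < x i \<longrightarrow>
     (\<exists>j. x j < y j \<and> x - unit_vec i + unit_vec j \<in> S \<and> y + unit_vec i - unit_vec j \<in> S \<and>
        \<phi> (x - unit_vec i + unit_vec j) + \<phi> (y + unit_vec i - unit_vec j) \<le> \<phi> x + \<phi> y))"

definition l1_dist :: "'a set \<Rightarrow> ('a \<Rightarrow> int) \<Rightarrow> ('a \<Rightarrow> int) \<Rightarrow> nat" where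
  "l1_dist E x y = nat (\<Sum>i\<in>E. \<bar>x i - y i\<bar>)"

text \<open>
This is \<open>\<phi>\<^sup>u = argmin (\<phi> - \<langle>u, \<cdot>\<rangle>)\<close>, the set \<open>minimizers\<close> in terms of real values.
\<close>

definition opt :: "'a set \<Rightarrow> ('a \<Rightarrow> int) set \<Rightarrow> (('a \<Rightarrow> int) \<Rightarrow> real) \<Rightarrow> ('a \<Rightarrow> real) \<Rightarrow>
    ('a \<Rightarrow> int) set" where
  "opt E S \<phi> u = {x \<in> S. \<forall>z\<in>S. \<phi> x - pairing E u x \<le> \<phi> z - pairing E u z}"

lemma M_exchangeE:
  assumes "M_exchange S \<phi>" "x \<in> S" "y \<in> S" "y i < x i"
  obtains j where "x j < y j" "x - unit_vec i + unit_vec j \<in> S" "y + unit_vec i - unit_vec j \<in> S"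
    "\<phi> (x - unit_vec i + unit_vec j) + \<phi> (y + unit_vec i - unit_vec j) \<le> \<phi> x + \<phi> y"
  using assms unfolding M_exchange_def by blast

lemma coord_sum_add: "coord_sum A (x + y) = coord_sum A x + coord_sum A y"
  by (simp add: coord_sum_def sum.distrib)

lemma coord_sum_diff: "coord_sum A (x - y) = coord_sum A x - coord_sum A y"
  by (simp add: coord_sum_def sum_subtractf)

lemma coord_sum_unit_vec: "finite A \<Longrightarrow> coord_sum A (unit_vec j) = (if j \<in> A then 1 else 0)"
  by (simp add: coord_sum_def unit_vec_def)

lemmas coord_sum_simps = coord_sum_add coord_sum_diff coord_sum_unit_vec

lemma pairing_add: "pairing E u (x + y) = pairing E u x + pairing E u y"
  by (simp add: pairing_def sum.distrib algebra_simps)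

lemma pairing_diff: "pairing E u (x - y) = pairing E u x - pairing E u y"
  by (simp add: pairing_def sum_subtractf algebra_simps)

lemma pairing_unit_vec: "finite E \<Longrightarrow> j \<in> E \<Longrightarrow> pairing E u (unit_vec j) = u j"
  by (simp add: pairing_def unit_vec_def if_distrib cong: if_cong)

lemma pairing_raise_coordinate:
  assumes "finite E" "i \<in> E"
  shows "pairing E (u(i := u i + s)) x = pairing E u x + s * real_of_int (x i)"
proof -
  have "pairing E (u(i := u i + s)) x
      = (\<Sum>k\<in>E. u k * real_of_int (x k) + (if k = i then s * real_of_int (x i) else 0))"
    unfolding pairing_def by (rule sum.cong) (auto simp: algebra_simps)
  then show ?thesis
    using assms by (simp add: sum.distrib pairing_def)
qed

lemmas pairing_simps = pairing_add pairing_diff pairing_unit_vec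

lemma l1_dist_less:
  assumes "finite E" "i \<in> E"
    and "\<And>k. k \<in> E \<Longrightarrow> \<bar>x' k - y k\<bar> \<le> \<bar>x k - y k\<bar>" and "\<bar>x' i - y i\<bar> < \<bar>x i - y i\<bar>"
  shows "l1_dist E x' y < l1_dist E x y"
proof -
  have "(\<Sum>k\<in>E. \<bar>x' k - y k\<bar>) < (\<Sum>k\<in>E. \<bar>x k - y k\<bar>)"
    using assms by (intro sum_strict_mono_ex1) auto
  moreover have "0 \<le> (\<Sum>k\<in>E. \<bar>x' k - y k\<bar>)"
    by (simp add: sum_nonneg)
  ultimately show ?thesis
    unfolding l1_dist_def by linarith
qed

lemma l1_dist_exchange_less:
  assumes "finite E" "i \<in> E" "y i < x i" "x j < y j"
  shows "l1_dist E (x - unit_vec i + unit_vec j) y < l1_dist E x y"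
  by (rule l1_dist_less[OF assms(1,2)]) (use assms(3,4) in \<open>auto simp: unit_vec_def\<close>)

lemma support_in_lattice:
  assumes "S \<subseteq> lattice_vecs E" "x \<in> S" "y \<in> S" "x i < y i"
  shows "i \<in> E"
proof (rule ccontr)
  assume "i \<notin> E"
  then have "x i = 0" "y i = 0" using assms by (auto simp: lattice_vecs_def)
  then show False using assms(4) by simp
qed

section \<open>Linear minimizers\<close>

text \<open>
An exchange between two minimizers cannot lower the total value, and the linear form takes the same
total before and after it; hence both new points are minimizers again.
\<close>

lemma M_exchange_opt:
  assumes "finite E" "S \<subseteq> lattice_vecs E" "M_exchange S \<phi>"
  shows "M_exchange (opt E S \<phi> u) \<phi>"
  unfolding M_exchange_def
proof (intro ballI allI impI)
  fix x y i assume xy: "x \<in> opt E S \<phi> u" "y \<in> opt E S \<phi> u" "y i < x i"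
  then have S: "x \<in> S" "y \<in> S" by (auto simp: opt_def)
  obtain j where j: "x j < y j" "x - unit_vec i + unit_vec j \<in> S" "y + unit_vec i - unit_vec j \<in> S"
    "\<phi> (x - unit_vec i + unit_vec j) + \<phi> (y + unit_vec i - unit_vec j) \<le> \<phi> x + \<phi> y"
    using M_exchangeE[OF assms(3) S xy(3)] .
  have "i \<in> E" "j \<in> E"
    using support_in_lattice[OF assms(2)] S xy(3) j(1) by blast+
  then have p: "pairing E u (x - unit_vec i + unit_vec j) = pairing E u x - u i + u j"
    "pairing E u (y + unit_vec i - unit_vec j) = pairing E u y + u i - u j"
    using assms(1) by (simp_all add: pairing_simps)
  have *: "\<phi> x - pairing E u x \<le> \<phi> z - pairing E u z" "\<phi> y - pairing E u y \<le> \<phi> z - pairing E u z"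
    if "z \<in> S" for z using xy(1,2) that by (auto simp: opt_def)
  have l: "\<phi> (x - unit_vec i + unit_vec j) - pairing E u (x - unit_vec i + unit_vec j)
      \<le> \<phi> x - pairing E u x"
    using *(2)[OF j(3)] j(4) unfolding p by linarith
  have r: "\<phi> (y + unit_vec i - unit_vec j) - pairing E u (y + unit_vec i - unit_vec j)
      \<le> \<phi> y - pairing E u y"
    using *(1)[OF j(2)] j(4) unfolding p by linarith
  have "x - unit_vec i + unit_vec j \<in> opt E S \<phi> u" "y + unit_vec i - unit_vec j \<in> opt E S \<phi> u"
    using j(2,3) *(1) *(2) order_trans[OF l] order_trans[OF r] unfolding opt_def by blast+
  then show "\<exists>j. x j < y j \<and> x - unit_vec i + unit_vec j \<in> opt E S \<phi> u \<and>
      y + unit_vec i - unit_vec j \<in> opt E S \<phi> u \<and>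
      \<phi> (x - unit_vec i + unit_vec j) + \<phi> (y + unit_vec i - unit_vec j) \<le> \<phi> x + \<phi> y"
    using j by blast
qed

text \<open>
Take a point \<open>z\<close> and exchange it one step towards \<open>y\<close>. The partner point is a neighbour of \<open>y\<close>, so
it is not better than \<open>y\<close>, and therefore the new point is not worse than \<open>z\<close>. Iterating this leads
from any \<open>z\<close> to \<open>y\<close> without ever increasing the value.
\<close>

lemma opt_if_locally_optimal:
  assumes "finite E" "S \<subseteq> lattice_vecs E" "M_exchange S \<phi>" "y \<in> S"
    and local: "\<And>k l. k \<noteq> l \<Longrightarrow> k \<in> E \<Longrightarrow> l \<in> E \<Longrightarrow> y - unit_vec k + unit_vec l \<in> S \<Longrightarrow>
      \<phi> y \<le> \<phi> (y - unit_vec k + unit_vec l) + u k - u l"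
    and sum: "\<And>x. x \<in> S \<Longrightarrow> coord_sum E x = r"
  shows "y \<in> opt E S \<phi> u"
proof -
  have "\<phi> y - pairing E u y \<le> \<phi> z - pairing E u z" if "z \<in> S" for z
    using that
  proof (induction "l1_dist E z y" arbitrary: z rule: less_induct)
    case less
    show ?case
    proof (cases "\<exists>i\<in>E. y i < z i")
      case True
      then obtain i where i: "i \<in> E" "y i < z i" by blast
      obtain j where j: "z j < y j" "z - unit_vec i + unit_vec j \<in> S"
        "y + unit_vec i - unit_vec j \<in> S"
        "\<phi> (z - unit_vec i + unit_vec j) + \<phi> (y + unit_vec i - unit_vec j) \<le> \<phi> z + \<phi> y"
        using M_exchangeE[OF assms(3) less.prems assms(4) i(2)] .
      have jE: "j \<in> E" "j \<noteq> i"
        using support_in_lattice[OF assms(2) less.prems assms(4) j(1)] j(1) i by auto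
      have eq: "y + unit_vec i - unit_vec j = y - unit_vec j + unit_vec i"
        by (simp add: algebra_simps)
      have "\<phi> y \<le> \<phi> (y + unit_vec i - unit_vec j) + u j - u i"
        using local[of j i] jE i(1) j(3) unfolding eq by blast
      moreover have "\<phi> y - pairing E u y \<le> \<phi> (z - unit_vec i + unit_vec j)
          - pairing E u (z - unit_vec i + unit_vec j)"
        by (rule less.hyps) (use l1_dist_exchange_less[OF assms(1) i j(1)] j(2) in auto)
      ultimately show ?thesis
        using j(4) assms(1) i(1) jE(1) by (simp add: pairing_simps)
    next
      case False
      then have le: "\<forall>i\<in>E. z i \<le> y i" by auto
      have "z = y"
      proof (rule ccontr)
        assume "z \<noteq> y"
        then obtain i where "z i \<noteq> y i" by auto
        moreover from this have "i \<in> E"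
          using support_in_lattice[OF assms(2)] less.prems assms(4) by (metis linorder_neqE)
        ultimately have "coord_sum E z < coord_sum E y"
          unfolding coord_sum_def using assms(1) le
          by (intro sum_strict_mono_ex1) (auto intro!: bexI[of _ i] simp: order.strict_iff_order)
        then show False using sum less.prems assms(4) by simp
      qed
      then show ?thesis by simp
    qed
  qed
  then show ?thesis using assms(4) by (simp add: opt_def)
qed

text \<open>
A vector that obeys all the rank inequalities of an M-convex set lies below one of its points. Let
\<open>x\<close> have the smallest total deficit, suppose \<open>x i < y i\<close>, and let \<open>K\<close> consist of \<open>i\<close> and all \<open>j\<close>
from which a unit of \<open>x\<close> can be moved to \<open>i\<close>. By the choice of \<open>x\<close> no \<open>j \<in> K\<close> has a surplus, so
\<open>x(K) < y(K)\<close>. But \<open>x\<close> maximizes the sum over \<open>K\<close>: otherwise some unit could be moved into \<open>K\<close>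
from an index outside of \<open>K\<close>, and then, moves being transitive, also to \<open>i\<close>.
\<close>

lemma dominating_base:
  assumes "finite E" "S \<subseteq> lattice_vecs E" "M_exchange S \<phi>"
    and bound: "\<And>A. A \<subseteq> E \<Longrightarrow> \<exists>x\<in>S. coord_sum A y \<le> coord_sum A x"
  shows "\<exists>x\<in>S. \<forall>i\<in>E. y i \<le> x i"
proof -
  define deficit where "deficit x = (\<Sum>i\<in>E. nat (y i - x i))" for x
  obtain x where x: "x \<in> S" "\<And>z. z \<in> S \<Longrightarrow> deficit x \<le> deficit z"
    using ex_has_least_nat[of "\<lambda>x. x \<in> S" _ deficit] bound[of "{}"] by auto
  have "y i \<le> x i" if i: "i \<in> E" for i
  proof (rule ccontr)
    assume "\<not> y i \<le> x i"
    then have xi: "x i < y i" by simp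
    define K where "K = {j\<in>E. j = i \<or> x + unit_vec i - unit_vec j \<in> S}"
    have K: "finite K" "K \<subseteq> E" "i \<in> K" using assms(1) i by (auto simp: K_def)
    have "x j \<le> y j" if "j \<in> K" for j
    proof (rule ccontr)
      assume "\<not> x j \<le> y j"
      then have "y j < x j" "j \<noteq> i" using xi by auto
      then have "deficit (x + unit_vec i - unit_vec j) < deficit x"
        unfolding deficit_def using assms(1) i xi
        by (intro sum_strict_mono_ex1) (auto simp: unit_vec_def intro!: bexI[of _ i])
      then show False
        using x(2)[of "x + unit_vec i - unit_vec j"] \<open>j \<in> K\<close> \<open>j \<noteq> i\<close> by (auto simp: K_def)
    qed
    then have "coord_sum K x < coord_sum K y"
      unfolding coord_sum_def using K xi by (intro sum_strict_mono_ex1) auto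
    then have "\<exists>z. z \<in> S \<and> coord_sum K x < coord_sum K z"
      using bound[OF K(2)] by force
    then obtain z where z: "z \<in> S" "coord_sum K x < coord_sum K z"
      "\<And>z'. z' \<in> S \<Longrightarrow> coord_sum K x < coord_sum K z' \<Longrightarrow> l1_dist E z x \<le> l1_dist E z' x"
      using ex_has_least_nat[of "\<lambda>z. z \<in> S \<and> coord_sum K x < coord_sum K z" _ "\<lambda>z. l1_dist E z x"]
      by blast
    obtain k where k: "k \<in> K" "x k < z k"
      using z(2) sum_mono[of K z x] unfolding coord_sum_def by (meson linorder_not_le)
    obtain j where j: "z j < x j" "z - unit_vec k + unit_vec j \<in> S" "x + unit_vec k - unit_vec j \<in> S"
      using M_exchangeE[OF assms(3) z(1) x(1) k(2)] by metis
    have "j \<in> E" using support_in_lattice[OF assms(2) z(1) x(1) j(1)] .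
    have "j \<notin> K"
    proof
      assume "j \<in> K"
      then have "coord_sum K (z - unit_vec k + unit_vec j) = coord_sum K z"
        using K(1) k(1) by (simp add: coord_sum_simps)
      then have "l1_dist E z x \<le> l1_dist E (z - unit_vec k + unit_vec j) x"
        using z(2,3) j(2) by simp
      then show False
        using l1_dist_exchange_less[of E k x z j] assms(1) K(2) k j(1) by auto
    qed
    have "k \<noteq> i" using \<open>j \<notin> K\<close> \<open>j \<in> E\<close> j(3) by (auto simp: K_def)
    have "j \<noteq> i" "j \<noteq> k" using \<open>j \<notin> K\<close> K(3) k(1) by auto
    \<comment> \<open>Moves from \<open>j\<close> to \<open>k\<close> and from \<open>k\<close> to \<open>i\<close> compose to one from \<open>j\<close> to \<open>i\<close>.\<close>
    have a: "x + unit_vec i - unit_vec k \<in> S" using k(1) \<open>k \<noteq> i\<close> by (auto simp: K_def)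
    have "(x + unit_vec k - unit_vec j) i < (x + unit_vec i - unit_vec k) i"
      using \<open>k \<noteq> i\<close> \<open>j \<noteq> i\<close> by (simp add: unit_vec_def)
    then obtain l where l: "(x + unit_vec i - unit_vec k) l < (x + unit_vec k - unit_vec j) l"
      "x + unit_vec k - unit_vec j + unit_vec i - unit_vec l \<in> S"
      using M_exchangeE[OF assms(3) a j(3)] by metis
    have "l = k" using l(1) by (auto simp: unit_vec_def split: if_splits)
    then have "x + unit_vec i - unit_vec j \<in> S" using l(2) by (simp add: algebra_simps)
    then show False using \<open>j \<notin> K\<close> \<open>j \<in> E\<close> by (simp add: K_def)
  qed
  then show ?thesis using x(1) by blast
qed

section \<open>Lifting minimizers, and coordinate cuts\<close>

text \<open>
For functions whose ranks differ by one, this is a consequence of condition (D) that mentions single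
points only. It passes to the restrictions of both functions to \<open>m \<le> x i\<close>.
\<close>

definition lifts_minimizers :: "'a set \<Rightarrow> ('a \<Rightarrow> int) set \<Rightarrow> (('a \<Rightarrow> int) \<Rightarrow> real) \<Rightarrow>
    ('a \<Rightarrow> int) set \<Rightarrow> (('a \<Rightarrow> int) \<Rightarrow> real) \<Rightarrow> bool" where
  "lifts_minimizers E T \<psi> S \<phi> \<longleftrightarrow>
     (\<forall>u. \<forall>y\<in>opt E T \<psi> u. \<exists>j\<in>E. y + unit_vec j \<in> opt E S \<phi> u)"

lemma M_exchange_cut:
  assumes "M_exchange S \<phi>"
  shows "M_exchange {x \<in> S. m \<le> x i} \<phi>"
  unfolding M_exchange_def
proof (intro ballI allI impI)
  fix x y k assume xy: "x \<in> {x \<in> S. m \<le> x i}" "y \<in> {x \<in> S. m \<le> x i}" "y k < x k"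
  obtain j where j: "x j < y j" "x - unit_vec k + unit_vec j \<in> S" "y + unit_vec k - unit_vec j \<in> S"
    "\<phi> (x - unit_vec k + unit_vec j) + \<phi> (y + unit_vec k - unit_vec j) \<le> \<phi> x + \<phi> y"
    using M_exchangeE[OF assms, of x y k] xy by blast
  moreover have "m \<le> (x - unit_vec k + unit_vec j) i" "m \<le> (y + unit_vec k - unit_vec j) i"
    using xy j(1) by (auto simp: unit_vec_def)
  ultimately show "\<exists>j. x j < y j \<and> x - unit_vec k + unit_vec j \<in> {x \<in> S. m \<le> x i} \<and>
      y + unit_vec k - unit_vec j \<in> {x \<in> S. m \<le> x i} \<and>
      \<phi> (x - unit_vec k + unit_vec j) + \<phi> (y + unit_vec k - unit_vec j) \<le> \<phi> x + \<phi> y"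
    by blast
qed

text \<open>
A minimizer \<open>y\<close> of the restricted function is a minimizer of the unrestricted one for a linear form
with a larger coefficient at \<open>i\<close>: the increase \<open>s\<close> is a Lagrange multiplier for the constraint
\<open>m \<le> y i\<close>. With \<open>U\<close> for the new form, the hypothesis gives a minimizer \<open>y + e\<^sub>j\<close> of \<open>\<phi> - U\<close>, and
this solves the restricted problem whenever \<open>s = 0\<close>, or \<open>y i = m\<close> and \<open>j \<noteq> i\<close>. The smallest possible
\<open>s\<close> is chosen, so that for \<open>s > 0\<close> some neighbour of \<open>y\<close> with \<open>i\<close>-th coordinate \<open>m - 1\<close> is also
optimal. Lifting that neighbour gives a second minimizer of \<open>\<phi> - U\<close>, with \<open>i\<close>-th coordinate at
most \<open>m\<close>, and an exchange with it repairs the case \<open>j = i\<close>.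
\<close>

lemma lifts_minimizers_cut:
  assumes E: "finite E" "i \<in> E"
    and S: "S \<subseteq> lattice_vecs E" "M_exchange S \<phi>"
    and T: "T \<subseteq> lattice_vecs E" "M_exchange T \<psi>" "\<And>y. y \<in> T \<Longrightarrow> coord_sum E y = r"
    and lifts: "lifts_minimizers E T \<psi> S \<phi>"
  shows "lifts_minimizers E {y \<in> T. m \<le> y i} \<psi> {x \<in> S. m \<le> x i} \<phi>"
  unfolding lifts_minimizers_def
proof (intro allI ballI)
  fix u y assume y: "y \<in> opt E {y \<in> T. m \<le> y i} \<psi> u"
  then have yT: "y \<in> T" "m \<le> y i"
    and ymin: "\<And>z. z \<in> T \<Longrightarrow> m \<le> z i \<Longrightarrow> \<psi> y - pairing E u y \<le> \<psi> z - pairing E u z"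
    by (auto simp: opt_def)
  define gain where
    "gain l = \<psi> y - \<psi> (y - unit_vec i + unit_vec l) - u i + u l" for l
  define L where "L = {l\<in>E. l \<noteq> i \<and> y - unit_vec i + unit_vec l \<in> T}"
  define s where "s = Max (insert 0 (gain ` L))"
  have L: "finite L" using E(1) by (simp add: L_def)
  then have s: "0 \<le> s" "\<And>l. l \<in> L \<Longrightarrow> gain l \<le> s" "s = 0 \<or> (\<exists>l\<in>L. s = gain l)"
    using Max_in[of "insert 0 (gain ` L)"] by (auto simp: s_def)
  define U where "U = u(i := u i + s)"
  have U: "pairing E U x = pairing E u x + s * real_of_int (x i)" for x
    unfolding U_def by (rule pairing_raise_coordinate[OF E])
  have yU: "y \<in> opt E T \<psi> U"
  proof (rule opt_if_locally_optimal[OF E(1) T(1,2) yT(1) _ T(3)])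
    fix k l assume kl: "k \<noteq> l" "k \<in> E" "l \<in> E" "y - unit_vec k + unit_vec l \<in> T"
    let ?z = "y - unit_vec k + unit_vec l"
    consider "k = i" | "l = i" | "k \<noteq> i" "l \<noteq> i" by blast
    then show "\<psi> y \<le> \<psi> ?z + U k - U l"
    proof cases
      case 1
      then have "l \<in> L" using kl by (auto simp: L_def)
      then show ?thesis using s(2)[of l] kl(1) 1 by (auto simp: gain_def U_def)
    next
      case 2
      \<comment> \<open>Only here can \<open>s\<close> be too large; then exchange \<open>?z\<close> with the neighbour that determines \<open>s\<close>.\<close>
      have "m \<le> ?z i" using yT(2) kl(1) 2 by (simp add: unit_vec_def)
      then have "\<psi> y \<le> \<psi> ?z + u k - u l - s" if "s = 0"
        using ymin[OF kl(4)] kl(2,3) that E(1) by (simp add: pairing_simps)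
      moreover have "\<psi> y \<le> \<psi> ?z + u k - u l - s" if q: "q \<in> L" "s = gain q" for q
      proof -
        let ?z' = "y - unit_vec i + unit_vec q"
        have q': "q \<in> E" "q \<noteq> i" "?z' \<in> T" using q(1) by (auto simp: L_def)
        have "?z' i < ?z i" using kl(1) q'(2) 2 by (simp add: unit_vec_def)
        then obtain j where j: "?z j < ?z' j" "?z - unit_vec i + unit_vec j \<in> T"
          "?z' + unit_vec i - unit_vec j \<in> T"
          "\<psi> (?z - unit_vec i + unit_vec j) + \<psi> (?z' + unit_vec i - unit_vec j) \<le> \<psi> ?z + \<psi> ?z'"
          using M_exchangeE[OF T(2) kl(4) q'(3)] by metis
        let ?v = "y - unit_vec k + unit_vec q"
        have jkq: "j = k \<or> j = q"
          using j(1) 2 by (auto simp: unit_vec_def split: if_splits)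
        have eqs: "?z - unit_vec i + unit_vec k = y" "?z' + unit_vec i - unit_vec k = ?v"
          "?z - unit_vec i + unit_vec q = ?v" "?z' + unit_vec i - unit_vec q = y"
          using 2 by (auto simp: algebra_simps)
        have v: "?v \<in> T" "\<psi> y + \<psi> ?v \<le> \<psi> ?z + \<psi> ?z'"
          using j(2-4) jkq by (metis eqs add.commute)+
        have "m \<le> ?v i" using yT(2) kl(1) 2 q'(2) by (simp add: unit_vec_def)
        then have "\<psi> y \<le> \<psi> ?v + u k - u q"
          using ymin[OF v(1)] kl(2) q'(1) E(1) by (simp add: pairing_simps)
        then show ?thesis using v(2) q(2) 2 by (simp add: gain_def)
      qed
      ultimately have "\<psi> y \<le> \<psi> ?z + u k - u l - s" using s(3) by blast
      then show ?thesis using kl(1) 2 by (simp add: U_def)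
    next
      case 3
      then have "m \<le> ?z i" using yT(2) by (simp add: unit_vec_def)
      then show ?thesis using ymin[OF kl(4)] kl(2,3) E(1) 3 by (simp add: pairing_simps U_def)
    qed
  qed
  obtain j where j: "j \<in> E" "y + unit_vec j \<in> opt E S \<phi> U"
    using lifts yU by (auto simp: lifts_minimizers_def)
  \<comment> \<open>The additional clause is complementary slackness for \<open>y + e\<^sub>j\<close>.\<close>
  have "\<exists>j\<in>E. y + unit_vec j \<in> opt E S \<phi> U \<and> (s = 0 \<or> j \<noteq> i \<and> y i = m)"
  proof (cases "s = 0 \<or> j \<noteq> i \<and> y i = m")
    case True
    then show ?thesis using j by blast
  next
    case False
    then obtain l where l: "l \<in> L" "s = gain l" "0 < s" using s(1,3) by auto
    let ?z = "y - unit_vec i + unit_vec l"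
    have l': "l \<in> E" "l \<noteq> i" "?z \<in> T" using l(1) by (auto simp: L_def)
    have "\<not> m \<le> ?z i"
    proof
      assume "m \<le> ?z i"
      then have "gain l \<le> 0"
        using ymin[OF l'(3)] l'(1) E by (simp add: gain_def pairing_simps)
      then show False using l(2,3) by simp
    qed
    then have yi: "y i = m" using yT(2) l'(2) by (simp add: unit_vec_def)
    then have ji: "j = i" using False by simp
    have "\<psi> ?z - pairing E U ?z = \<psi> y - pairing E U y"
      using l'(1,2) l(2) E unfolding U
      by (simp add: gain_def pairing_simps algebra_simps) (simp add: unit_vec_def algebra_simps)
    then have "?z \<in> opt E T \<psi> U" using yU l'(3) by (auto simp: opt_def)
    then obtain q where q: "q \<in> E" "?z + unit_vec q \<in> opt E S \<phi> U"
      using lifts by (auto simp: lifts_minimizers_def)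
    have lt: "(?z + unit_vec q) i < (y + unit_vec j) i"
      using ji l'(2) by (simp add: unit_vec_def)
    obtain k where k: "(y + unit_vec j) k < (?z + unit_vec q) k"
      "y + unit_vec j - unit_vec i + unit_vec k \<in> opt E S \<phi> U"
      using M_exchangeE[OF M_exchange_opt[OF E(1) S] j(2) q(2) lt] by metis
    have "k \<noteq> i" using k(1) lt by auto
    moreover have "k \<in> E"
      by (rule support_in_lattice[of S E "y + unit_vec j" "?z + unit_vec q"])
        (use S(1) j(2) q(2) k(1) in \<open>auto simp: opt_def\<close>)
    moreover have "y + unit_vec k \<in> opt E S \<phi> U" using k(2) ji by (simp add: algebra_simps)
    ultimately show ?thesis using yi by blast
  qed
  then obtain k where k: "k \<in> E" "y + unit_vec k \<in> opt E S \<phi> U" "s = 0 \<or> k \<noteq> i \<and> y i = m"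
    by blast
  have "y + unit_vec k \<in> opt E {x \<in> S. m \<le> x i} \<phi> u"
  proof -
    have "y + unit_vec k \<in> S" using k(2) by (simp add: opt_def)
    moreover have "m \<le> (y + unit_vec k) i" using yT(2) by (auto simp: unit_vec_def)
    moreover have "\<phi> (y + unit_vec k) - pairing E u (y + unit_vec k) \<le> \<phi> z - pairing E u z"
      if z: "z \<in> S" "m \<le> z i" for z
    proof -
      have "\<phi> (y + unit_vec k) - pairing E U (y + unit_vec k) \<le> \<phi> z - pairing E U z"
        using k(2) z(1) by (simp add: opt_def)
      moreover have "s * real_of_int ((y + unit_vec k) i) \<le> s * real_of_int (z i)"
      proof (cases "s = 0")
        case False
        then have "(y + unit_vec k) i \<le> z i" using k(3) z(2) by (auto simp: unit_vec_def)
        then show ?thesis using s(1) by (intro mult_left_mono) auto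
      qed simp
      ultimately show ?thesis unfolding U by linarith
    qed
    ultimately show ?thesis by (simp add: opt_def)
  qed
  then show "\<exists>j\<in>E. y + unit_vec j \<in> opt E {x \<in> S. m \<le> x i} \<phi> u" using k(1) by blast
qed

lemma lifts_minimizers_above:
  assumes "finite E" "finite A" "A \<subseteq> E"
    and S: "S \<subseteq> lattice_vecs E" "M_exchange S \<phi>"
    and T: "T \<subseteq> lattice_vecs E" "M_exchange T \<psi>" "\<And>y. y \<in> T \<Longrightarrow> coord_sum E y = r"
    and "lifts_minimizers E T \<psi> S \<phi>"
  shows "lifts_minimizers E {y \<in> T. \<forall>i\<in>A. w i \<le> y i} \<psi> {x \<in> S. \<forall>i\<in>A. w i \<le> x i} \<phi> \<and>
    M_exchange {y \<in> T. \<forall>i\<in>A. w i \<le> y i} \<psi> \<and> M_exchange {x \<in> S. \<forall>i\<in>A. w i \<le> x i} \<phi>"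
  using assms(2,3)
proof (induction A rule: finite_induct)
  case empty
  then show ?case using assms by simp
next
  case (insert a A)
  let ?T = "{y \<in> T. \<forall>i\<in>A. w i \<le> y i}" and ?S = "{x \<in> S. \<forall>i\<in>A. w i \<le> x i}"
  have IH: "lifts_minimizers E ?T \<psi> ?S \<phi>" "M_exchange ?T \<psi>" "M_exchange ?S \<phi>"
    using insert by auto
  have "lifts_minimizers E {y \<in> ?T. w a \<le> y a} \<psi> {x \<in> ?S. w a \<le> x a} \<phi>"
    by (rule lifts_minimizers_cut[where r = r]) (use assms(1) insert.prems S(1) T(1,3) IH in auto)
  moreover have "{y \<in> T. \<forall>i\<in>insert a A. w i \<le> y i} = {y \<in> ?T. w a \<le> y a}"
    "{x \<in> S. \<forall>i\<in>insert a A. w i \<le> x i} = {x \<in> ?S. w a \<le> x a}" by auto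
  ultimately show ?case using M_exchange_cut[OF IH(2)] M_exchange_cut[OF IH(3)] by simp
qed

section \<open>Exchange between adjacent layers\<close>

definition adjacent_exchange :: "('a \<Rightarrow> int) set \<Rightarrow> (('a \<Rightarrow> int) \<Rightarrow> real) \<Rightarrow>
    ('a \<Rightarrow> int) set \<Rightarrow> (('a \<Rightarrow> int) \<Rightarrow> real) \<Rightarrow> bool" where
  "adjacent_exchange S \<phi> T \<psi> \<longleftrightarrow> (\<forall>x\<in>S. \<forall>y\<in>T. \<exists>j. y j < x j \<and> x - unit_vec j \<in> T \<and>
     y + unit_vec j \<in> S \<and> \<psi> (x - unit_vec j) + \<phi> (y + unit_vec j) \<le> \<phi> x + \<psi> y)"

text \<open>
This is \<open>adjacent_exchange\<close> for the closest pairs that are not trivial: \<open>x = w + e\<^sub>a + e\<^sub>b\<close> and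
\<open>y = w + e\<^sub>c\<close>, where \<open>a = b\<close> is possible. For \<open>0/1\<close>-vectors it is a three-term Pluecker relation.
\<close>

definition local_exchange :: "('a \<Rightarrow> int) set \<Rightarrow> (('a \<Rightarrow> int) \<Rightarrow> real) \<Rightarrow>
    ('a \<Rightarrow> int) set \<Rightarrow> (('a \<Rightarrow> int) \<Rightarrow> real) \<Rightarrow> bool" where
  "local_exchange S \<phi> T \<psi> \<longleftrightarrow> (\<forall>x\<in>S. \<forall>a b c. c \<noteq> a \<and> c \<noteq> b \<and>
     x - unit_vec a - unit_vec b + unit_vec c \<in> T \<longrightarrow>
     (\<exists>p\<in>{a, b}. x - unit_vec p + unit_vec c \<in> S \<and>
        x - unit_vec a - unit_vec b + unit_vec p \<in> T \<and>
        \<phi> (x - unit_vec p + unit_vec c) + \<psi> (x - unit_vec a - unit_vec b + unit_vec p)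
          \<le> \<phi> x + \<psi> (x - unit_vec a - unit_vec b + unit_vec c)))"

lemma unit_step:
  assumes "finite E" "w \<in> lattice_vecs E" "z \<in> lattice_vecs E" "\<forall>i\<in>E. w i \<le> z i"
    and "coord_sum E z = coord_sum E w + 1"
  shows "\<exists>k\<in>E. z = w + unit_vec k"
proof -
  obtain k where k: "k \<in> E" "w k < z k"
    using assms(5) sum_mono[of E z w] unfolding coord_sum_def by force
  have "\<forall>i\<in>E. (w + unit_vec k) i \<le> z i"
    using k assms(4) by (auto simp: unit_vec_def)
  moreover have "(\<Sum>i\<in>E. z i - (w + unit_vec k) i) = 0"
    using assms(1,5) k(1) coord_sum_unit_vec[of E k]
    by (simp add: coord_sum_def sum_subtractf sum.distrib)
  ultimately have "\<forall>i\<in>E. z i - (w + unit_vec k) i = 0"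
    using assms(1) by (subst (asm) sum_nonneg_eq_0_iff) auto
  then have "z i = (w + unit_vec k) i" for i
    using assms(2,3) k(1) by (cases "i \<in> E") (auto simp: lattice_vecs_def unit_vec_def)
  then show ?thesis using k(1) by blast
qed

text \<open>
Write \<open>x = w + e\<^sub>a + e\<^sub>b\<close> and \<open>y = w + e\<^sub>c\<close>, and restrict to the vectors above \<open>w\<close>. On these, \<open>\<psi>\<close> has
only the arguments \<open>w + e\<^sub>k\<close>. If the exchange fails, the coefficients \<open>u\<^sub>a\<close> and \<open>u\<^sub>b\<close> can be
chosen such that \<open>y\<close> minimizes \<open>\<psi> - u\<close> whereas \<open>x\<close> is better for \<open>\<phi> - u\<close> than \<open>y + e\<^sub>a\<close> and
\<open>y + e\<^sub>b\<close>; the exchange between \<open>y + e\<^sub>c\<close> and \<open>x\<close> shows that it is also better than \<open>y + e\<^sub>c\<close>, and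
very negative coefficients exclude the other \<open>y + e\<^sub>j\<close>. So the minimizer \<open>y\<close> cannot be lifted.
\<close>

lemma local_exchange_if_lifts_minimizers:
  assumes E: "finite E"
    and S: "S \<subseteq> lattice_vecs E" "M_exchange S \<phi>"
    and T: "T \<subseteq> lattice_vecs E" "M_exchange T \<psi>" "\<And>y. y \<in> T \<Longrightarrow> coord_sum E y = r"
    and lifts: "lifts_minimizers E T \<psi> S \<phi>"
  shows "local_exchange S \<phi> T \<psi>"
  unfolding local_exchange_def
proof (intro ballI allI impI)
  fix x a b c
  assume x: "x \<in> S" and abc: "c \<noteq> a \<and> c \<noteq> b \<and> x - unit_vec a - unit_vec b + unit_vec c \<in> T"
  define w where "w = x - unit_vec a - unit_vec b"
  define y where "y = w + unit_vec c"
  have y: "y \<in> T" using abc by (simp add: y_def w_def)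
  have x_eq: "x = w + unit_vec a + unit_vec b" by (simp add: w_def)
  have "\<exists>p\<in>{a, b}. x - unit_vec p + unit_vec c \<in> S \<and> w + unit_vec p \<in> T \<and>
      \<phi> (x - unit_vec p + unit_vec c) + \<psi> (w + unit_vec p) \<le> \<phi> x + \<psi> y"
  proof (rule ccontr)
    assume contr: "\<not> ?thesis"
    let ?S = "{x \<in> S. \<forall>i\<in>E. w i \<le> x i}" and ?T = "{y \<in> T. \<forall>i\<in>E. w i \<le> y i}"
    have lifts': "lifts_minimizers E ?T \<psi> ?S \<phi>"
      using lifts_minimizers_above[OF E E subset_refl S T lifts] by blast
    \<comment> \<open>The largest coefficient for which \<open>w + e\<^sub>p\<close> does not beat \<open>y\<close>; a large one if there is no such point.\<close>
    define v where "v p = (if w + unit_vec p \<in> T then \<psi> (w + unit_vec p) - \<psi> y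
      else \<phi> x - \<phi> (x - unit_vec p + unit_vec c) + 1)" for p
    define u where "u k = (if k = c then 0 else if k = a \<or> k = b then v k
      else min (\<psi> (w + unit_vec k) - \<psi> y) (\<phi> (y + unit_vec k) - \<phi> x + v a + v b - 1))" for k
    have uabc: "u c = 0" "u a = v a" "u b = v b" using abc by (auto simp: u_def)
    have "x \<in> lattice_vecs E" "y \<in> lattice_vecs E" using x y S(1) T(1) by auto
    then have ST: "{x, y} \<subseteq> lattice_vecs E" by simp
    have abcE: "a \<in> E" "b \<in> E" "c \<in> E"
      using support_in_lattice[OF ST, of y x a] support_in_lattice[OF ST, of y x b]
        support_in_lattice[OF ST, of x y c] abc
      by (auto simp: y_def w_def unit_vec_def)
    then have w: "w \<in> lattice_vecs E"
      using ST by (auto simp: w_def lattice_vecs_def unit_vec_def)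
    have xS: "x \<in> ?S" using x by (simp add: w_def unit_vec_def)
    have "coord_sum E w + 1 = r"
      using T(3)[OF y] abcE(3) E by (simp add: y_def coord_sum_simps)
    have "y \<in> opt E ?T \<psi> u"
      unfolding opt_def
    proof (intro CollectI conjI ballI)
      show "y \<in> T" using y .
      show "\<And>i. i \<in> E \<Longrightarrow> w i \<le> y i" by (simp add: y_def unit_vec_def)
      fix z assume z: "z \<in> ?T"
      then obtain k where k: "k \<in> E" "z = w + unit_vec k"
        using unit_step[OF E w, of z] T(1,3) \<open>coord_sum E w + 1 = r\<close> by auto
      have "u k \<le> \<psi> (w + unit_vec k) - \<psi> y"
        using z k(2) by (auto simp: u_def v_def y_def)
      then show "\<psi> y - pairing E u y \<le> \<psi> z - pairing E u z"
        using E k abcE uabc(1) by (simp add: y_def pairing_simps)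
    qed
    then obtain j where j: "j \<in> E" "y + unit_vec j \<in> opt E ?S \<phi> u"
      using lifts' by (auto simp: lifts_minimizers_def)
    then have "y + unit_vec j \<in> S" by (simp add: opt_def)
    have better: "\<phi> (y + unit_vec j) - u j \<le> \<phi> x - v a - v b"
    proof -
      have "\<phi> (y + unit_vec j) - pairing E u (y + unit_vec j) \<le> \<phi> x - pairing E u x"
        using j(2) xS unfolding opt_def by blast
      then show ?thesis
        unfolding x_eq y_def using E j(1) abcE uabc by (simp add: pairing_simps)
    qed
    have worse: "\<phi> x - v p < \<phi> (x - unit_vec p + unit_vec c)"
      if "p \<in> {a, b}" "x - unit_vec p + unit_vec c \<in> S" for p
      using contr that by (auto simp: v_def not_le)
    have ya: "y + unit_vec a = x - unit_vec b + unit_vec c"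
      and yb: "y + unit_vec b = x - unit_vec a + unit_vec c"
      by (simp_all add: y_def x_eq algebra_simps)
    consider "j = a" | "j = b" | "j = c" | "j \<noteq> a" "j \<noteq> b" "j \<noteq> c" by blast
    then show False
    proof cases
      case 1
      then show ?thesis using worse[of b] better uabc \<open>y + unit_vec j \<in> S\<close> by (simp add: ya)
    next
      case 2
      then show ?thesis using worse[of a] better uabc \<open>y + unit_vec j \<in> S\<close> by (simp add: yb)
    next
      case 3
      have "x c < (y + unit_vec c) c" using abc by (simp add: y_def w_def unit_vec_def)
      moreover have "y + unit_vec c \<in> S" using 3 \<open>y + unit_vec j \<in> S\<close> by simp
      ultimately obtain l where l: "(y + unit_vec c) l < x l"
        "y + unit_vec c - unit_vec c + unit_vec l \<in> S" "x + unit_vec c - unit_vec l \<in> S"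
        "\<phi> (y + unit_vec c - unit_vec c + unit_vec l) + \<phi> (x + unit_vec c - unit_vec l)
          \<le> \<phi> (y + unit_vec c) + \<phi> x"
        using M_exchangeE[OF S(2) _ x] by metis
      have l_in: "l = a \<or> l = b"
        using l(1) by (auto simp: y_def w_def unit_vec_def split: if_splits)
      have xl: "x + unit_vec c - unit_vec l = x - unit_vec l + unit_vec c" for l
        by simp
      have yl: "y + unit_vec c - unit_vec c + unit_vec l = y + unit_vec l"
        by simp
      have "x - unit_vec a + unit_vec c \<in> S \<and> x - unit_vec b + unit_vec c \<in> S \<and>
          \<phi> (x - unit_vec a + unit_vec c) + \<phi> (x - unit_vec b + unit_vec c)
            \<le> \<phi> (y + unit_vec c) + \<phi> x"
        using l(2-4)[unfolded xl yl] l_in ya yb by (metis add.commute)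
      then show ?thesis
        using worse[of a] worse[of b] better uabc(1) 3 by simp
    next
      case 4
      then have "u j \<le> \<phi> (y + unit_vec j) - \<phi> x + v a + v b - 1" by (simp add: u_def)
      then show ?thesis using better by linarith
    qed
  qed
  then show "\<exists>p\<in>{a, b}. x - unit_vec p + unit_vec c \<in> S \<and>
        x - unit_vec a - unit_vec b + unit_vec p \<in> T \<and>
        \<phi> (x - unit_vec p + unit_vec c) + \<psi> (x - unit_vec a - unit_vec b + unit_vec p)
          \<le> \<phi> x + \<psi> (x - unit_vec a - unit_vec b + unit_vec c)"
    by (simp add: w_def y_def)
qed

text \<open>
An adaptation of Murota's proof that, on a suitable domain, local exchange implies exchange. It
proceeds by induction on the distance. The coefficients \<open>v\<close> are chosen such that, among the indices
\<open>l\<close> with \<open>y l < x l\<close> and \<open>x - e\<^sub>l\<close> in the domain of \<open>\<psi>\<close>, those with \<open>\<psi> (x - e\<^sub>l) + v l \<le> \<phi> x\<close> are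
exactly the valid exchanges for \<open>(x, y)\<close>. Moving \<open>x\<close> one step towards \<open>y\<close>, to the point
\<open>x - e\<^sub>b + e\<^sub>c\<close> that is best for a fixed \<open>c\<close> (values being corrected by \<open>v\<close>), the induction
hypothesis gives a valid index \<open>j\<close> for the new pair. The local exchange between \<open>x\<close> and
\<open>x - e\<^sub>j - e\<^sub>b + e\<^sub>c\<close> then shows that \<open>j\<close> or \<open>b\<close> is valid for the old one: in the second case because
\<open>b\<close> was the best choice.
\<close>

lemma adjacent_exchange_if_local:
  assumes E: "finite E" and ST: "S \<union> T \<subseteq> lattice_vecs E"
    and S: "M_exchange S \<phi>"
    and dom: "\<And>x y. x \<in> S \<Longrightarrow> y \<in> T \<Longrightarrow>
      \<exists>j. y j < x j \<and> x - unit_vec j \<in> T \<and> y + unit_vec j \<in> S"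
    and local: "local_exchange S \<phi> T \<psi>"
  shows "adjacent_exchange S \<phi> T \<psi>"
proof -
  have "\<exists>j. y j < x j \<and> x - unit_vec j \<in> T \<and> y + unit_vec j \<in> S \<and>
      \<psi> (x - unit_vec j) + \<phi> (y + unit_vec j) \<le> \<phi> x + \<psi> y"
    if "x \<in> S" "y \<in> T" for x y
    using that
  proof (induction "l1_dist E x y" arbitrary: x rule: less_induct)
    case less
    obtain d where d: "y d < x d" "x - unit_vec d \<in> T" "y + unit_vec d \<in> S"
      using dom[OF less.prems] by blast
    show ?case
    proof (cases "x = y + unit_vec d")
      case True
      then show ?thesis using d by (auto simp: algebra_simps)
    next
      case False
      \<comment> \<open>The points \<open>x\<close> and \<open>y + e\<^sub>d\<close> of \<open>S\<close> are incomparable: exchanges need both directions.\<close>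
      have "\<exists>c. x c < (y + unit_vec d) c"
      proof (rule ccontr)
        assume "\<nexists>c. x c < (y + unit_vec d) c"
        then have le: "\<And>c. (y + unit_vec d) c \<le> x c" by (meson not_le)
        obtain c where c: "(y + unit_vec d) c < x c"
          using False le by (metis ext order_le_less)
        obtain q where "x q < (y + unit_vec d) q"
          using M_exchangeE[OF S less.prems(1) d(3) c] by metis
        then show False using le[of q] by simp
      qed
      then obtain c where c: "x c < (y + unit_vec d) c" by blast
      have cd: "c \<noteq> d" "x c < y c" using c d(1) by (auto simp: unit_vec_def split: if_splits)
      have cE: "c \<in> E" using support_in_lattice[OF ST, of x y c] less.prems cd(2) by blast
      define J where "J = {j. y j < x j \<and> x - unit_vec j + unit_vec c \<in> S}"
      have JE: "j \<in> E" if "y j < x j" for j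
        using support_in_lattice[OF ST, of y x j] less.prems that by blast
      have "finite J" by (rule finite_subset[OF _ E]) (use JE in \<open>auto simp: J_def\<close>)
      obtain q where q: "(y + unit_vec d) q < x q" "x + unit_vec c - unit_vec q \<in> S"
        using M_exchangeE[OF S d(3) less.prems(1) c] by metis
      have "y q < x q" using q(1) by (auto simp: unit_vec_def split: if_splits)
      then have "q \<in> J" using q(2) by (simp add: J_def algebra_simps)
      define v where "v j = (if y + unit_vec j \<in> S then \<phi> (y + unit_vec j) - \<psi> y
        else \<phi> x - \<psi> (x - unit_vec j) + 1)" for j
      define key where "key j = \<phi> (x - unit_vec j + unit_vec c) + v j" for j
      obtain b where b: "b \<in> J" "\<And>j. j \<in> J \<Longrightarrow> key b \<le> key j"
        using \<open>finite J\<close> \<open>q \<in> J\<close> ex_min_if_finite[of "key ` J"] by (auto simp: not_less)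
      let ?x' = "x - unit_vec b + unit_vec c"
      have b': "y b < x b" "?x' \<in> S" using b(1) by (auto simp: J_def)
      have "l1_dist E ?x' y < l1_dist E x y"
        by (rule l1_dist_exchange_less[OF E JE[OF b'(1)] b'(1) cd(2)])
      then obtain j where j: "y j < ?x' j" "?x' - unit_vec j \<in> T" "y + unit_vec j \<in> S"
        "\<psi> (?x' - unit_vec j) + \<phi> (y + unit_vec j) \<le> \<phi> ?x' + \<psi> y"
        using less.hyps[OF _ b'(2) less.prems(2)] by blast
      have neq: "c \<noteq> j" "c \<noteq> b" using j(1) cd(2) b'(1) by (auto simp: unit_vec_def split: if_splits)
      have yj: "y j < x j" using j(1) neq(1) by (auto simp: unit_vec_def split: if_splits)
      have eq: "?x' - unit_vec j = x - unit_vec j - unit_vec b + unit_vec c"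
        by (simp add: algebra_simps)
      have "\<psi> (?x' - unit_vec j) + v j \<le> \<phi> ?x'" using j(3,4) by (simp add: v_def)
      then have up: "\<psi> (x - unit_vec j - unit_vec b + unit_vec c) + v j \<le> \<phi> ?x'"
        unfolding eq .
      have "x - unit_vec j - unit_vec b + unit_vec c \<in> T" using j(2) unfolding eq .
      then obtain p where p: "p \<in> {j, b}" "x - unit_vec p + unit_vec c \<in> S"
        "x - unit_vec j - unit_vec b + unit_vec p \<in> T"
        "\<phi> (x - unit_vec p + unit_vec c) + \<psi> (x - unit_vec j - unit_vec b + unit_vec p)
          \<le> \<phi> x + \<psi> (x - unit_vec j - unit_vec b + unit_vec c)"
        using local neq less.prems(1) unfolding local_exchange_def by blast
      obtain l where l: "y l < x l" "x - unit_vec l \<in> T" "\<psi> (x - unit_vec l) + v l \<le> \<phi> x"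
      proof (cases "p = b")
        case True
        have "x - unit_vec j - unit_vec b + unit_vec p = x - unit_vec j" using True by simp
        then show ?thesis using that[of j] p(3,4) up yj True by simp
      next
        case False
        then have pj: "p = j" using p(1) by simp
        have "x - unit_vec j - unit_vec b + unit_vec p = x - unit_vec b" using pj by simp
        moreover have "key b \<le> key j" using b(2) yj p(2) pj by (simp add: J_def)
        ultimately show ?thesis using that[of b] p(3,4) up b'(1) pj by (simp add: key_def)
      qed
      have "y + unit_vec l \<in> S"
        using l(3) by (auto simp: v_def split: if_splits)
      then show ?thesis using l by (auto simp: v_def)
    qed
  qed
  then show ?thesis unfolding adjacent_exchange_def by blast
qed

section \<open>M-convex functions as finite valued sets\<close>

definition val :: "(('a \<Rightarrow> int) \<Rightarrow> ereal) \<Rightarrow> ('a \<Rightarrow> int) \<Rightarrow> real" where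
  "val f x = real_of_ereal (f x)"

lemma ereal_eq_val:
  assumes "f x \<noteq> -\<infinity>" "x \<in> eff_dom f"
  shows "f x = ereal (val f x)"
  using assms by (cases "f x") (auto simp: eff_dom_def val_def)

lemma val_le_if_sum_le:
  assumes "f x \<noteq> -\<infinity>" "f x' \<noteq> -\<infinity>" "g y \<noteq> -\<infinity>" "g y' \<noteq> -\<infinity>"
    and "x \<in> eff_dom f" "y \<in> eff_dom g" "f x' + g y' \<le> f x + g y"
  shows "x' \<in> eff_dom f" "y' \<in> eff_dom g" "val f x' + val g y' \<le> val f x + val g y"
  using assms unfolding eff_dom_def val_def
  by (cases "f x"; cases "f x'"; cases "g y"; cases "g y'"; force)+

lemma finite_if_bounded_vecs:
  assumes "finite E" "P \<subseteq> lattice_vecs E" "bounded_vecs E P"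
  shows "finite P"
proof -
  obtain B where B: "\<forall>x\<in>P. \<forall>i\<in>E. \<bar>x i\<bar> \<le> B" using assms(3) by (auto simp: bounded_vecs_def)
  have "P \<subseteq> {x. \<forall>i. (i \<in> E \<longrightarrow> x i \<in> {- B..B}) \<and> (i \<notin> E \<longrightarrow> x i = 0)}"
  proof
    fix x assume "x \<in> P"
    then show "x \<in> {x. \<forall>i. (i \<in> E \<longrightarrow> x i \<in> {- B..B}) \<and> (i \<notin> E \<longrightarrow> x i = 0)}"
      using B assms(2) by (fastforce simp: lattice_vecs_def)
  qed
  then show ?thesis
    using finite_set_of_finite_funs[OF assms(1), of "{- B..B}" 0] finite_subset by blast
qed

lemma exists_smaller_coordinate:
  assumes "finite E"
    and "coord_sum E x < coord_sum E y \<or> coord_sum E x = coord_sum E y \<and> i \<in> E \<and> y i < x i"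
  shows "\<exists>j\<in>E. x j < y j"
proof (rule ccontr)
  assume "\<not> ?thesis"
  then have le: "\<forall>j\<in>E. y j \<le> x j" by force
  then have "coord_sum E y \<le> coord_sum E x" unfolding coord_sum_def by (auto intro: sum_mono)
  moreover have "coord_sum E y < coord_sum E x" if "i \<in> E" "y i < x i"
    unfolding coord_sum_def using assms(1) le that by (intro sum_strict_mono_ex1) auto
  ultimately show False using assms(2) by auto
qed

lemma Mnat_convex_finite:
  assumes "finite E" "Mnat_convex E h"
  shows "finite (eff_dom h)"
  using assms finite_if_bounded_vecs by (auto simp: Mnat_convex_def)

lemma Mnat_convex_descend:
  assumes "finite E" "Mnat_convex E h" "x \<in> eff_dom h" "y \<in> eff_dom h"
    and "coord_sum E y < coord_sum E x"
  obtains j where "j \<in> E" "y j < x j" "h (x - unit_vec j) + h (y + unit_vec j) \<le> h x + h y"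
proof -
  let ?F = "\<lambda>j. h (x - unit_vec j) + h (y + unit_vec j)"
  have "supp_pos E x y \<noteq> {}" "finite (supp_pos E x y)"
    using exists_smaller_coordinate[of E y x] assms(1,5) by (auto simp: supp_pos_def)
  then have "Min (?F ` supp_pos E x y) \<in> ?F ` supp_pos E x y" by simp
  moreover have "Min (?F ` supp_pos E x y) \<le> h x + h y"
    using assms(2-5) unfolding Mnat_convex_def by blast
  ultimately show ?thesis using that by (auto simp: supp_pos_def)
qed

lemma Mnat_convex_exchange:
  assumes "finite E" "Mnat_convex E h" "x \<in> eff_dom h" "y \<in> eff_dom h"
    and "coord_sum E y = coord_sum E x" "i \<in> E" "y i < x i"
  obtains j where "j \<in> E" "x j < y j"
    "h (x - unit_vec i + unit_vec j) + h (y + unit_vec i - unit_vec j) \<le> h x + h y"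
proof -
  let ?F = "\<lambda>j. h (x - unit_vec i + unit_vec j) + h (y + unit_vec i - unit_vec j)"
  have "supp_neg E x y \<noteq> {}" "finite (supp_neg E x y)"
    using exists_smaller_coordinate[of E x y i] assms(1,5,6,7) by (auto simp: supp_pos_def supp_neg_def)
  then have "Min (?F ` supp_neg E x y) \<in> ?F ` supp_neg E x y" by simp
  moreover have "i \<in> supp_pos E x y" using assms(6,7) by (simp add: supp_pos_def)
  then have "Min (?F ` supp_neg E x y) \<le> h x + h y"
    using assms(2-5) unfolding Mnat_convex_def by simp
  ultimately show ?thesis using that by (auto simp: supp_pos_def supp_neg_def)
qed

text \<open>
The exchange property of a layer comes from that of the whole M\<open>\<^sup>\<natural>\<close>-convex function: an exchange between
points of equal coordinate sum keeps these sums.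
\<close>

lemma M_convex_properties:
  assumes "finite E" "M_convex E f"
  shows "f x \<noteq> -\<infinity>" "eff_dom f \<subseteq> lattice_vecs E" "eff_dom f \<noteq> {}" "finite (eff_dom f)"
    "x \<in> eff_dom f \<Longrightarrow> coord_sum E x = rk E f" "M_exchange (eff_dom f) (val f)"
proof -
  obtain h k where h: "Mnat_convex E h" "k \<in> coord_sum E ` eff_dom h" "f = layer_at E h k"
    using assms(2) by (auto simp: M_convex_def layers_def)
  have dom: "eff_dom f = {x \<in> eff_dom h. coord_sum E x = k}"
    by (auto simp: h(3) layer_at_def eff_dom_def)
  have hf: "h z \<noteq> -\<infinity>" for z using h(1) by (simp add: Mnat_convex_def)
  then show f: "f x \<noteq> -\<infinity>" for x by (simp add: h(3) layer_at_def)
  show lattice: "eff_dom f \<subseteq> lattice_vecs E" using h(1) by (auto simp: dom Mnat_convex_def)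
  show nonempty: "eff_dom f \<noteq> {}" using h(2) by (auto simp: dom)
  show "finite (eff_dom f)" using Mnat_convex_finite[OF assms(1) h(1)] by (simp add: dom)
  have "rk E f = k" unfolding rk_def
    by (rule the_equality) (use nonempty in \<open>auto simp: dom\<close>)
  then show "coord_sum E x = rk E f" if "x \<in> eff_dom f" using that by (simp add: dom)
  show "M_exchange (eff_dom f) (val f)"
    unfolding M_exchange_def
  proof (intro ballI allI impI)
    fix x y i assume xy: "x \<in> eff_dom f" "y \<in> eff_dom f" "y i < x i"
    then have h': "x \<in> eff_dom h" "y \<in> eff_dom h" "coord_sum E x = k" "coord_sum E y = k"
      "f x = h x" "f y = h y" unfolding dom by (auto simp: h(3) layer_at_def)
    have i: "i \<in> E" using support_in_lattice[OF lattice xy(2,1,3)] .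
    obtain j where j: "j \<in> E" "x j < y j"
      "h (x - unit_vec i + unit_vec j) + h (y + unit_vec i - unit_vec j) \<le> h x + h y"
      using Mnat_convex_exchange[OF assms(1) h(1) h'(1,2) _ i xy(3)] h'(3,4) by metis
    have "f (x - unit_vec i + unit_vec j) + f (y + unit_vec i - unit_vec j) \<le> f x + f y"
      using j(1,3) h'(3-6) i assms(1) by (simp add: h(3) layer_at_def coord_sum_simps)
    then show "\<exists>j. x j < y j \<and> x - unit_vec i + unit_vec j \<in> eff_dom f \<and>
        y + unit_vec i - unit_vec j \<in> eff_dom f \<and>
        val f (x - unit_vec i + unit_vec j) + val f (y + unit_vec i - unit_vec j)
          \<le> val f x + val f y"
      using val_le_if_sum_le[of f, OF f f f f xy(1,2)] j(2) by blast
  qed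
qed

lemma minimizers_eq_opt:
  assumes "\<And>x. f x \<noteq> -\<infinity>" "eff_dom f \<subseteq> lattice_vecs E" "eff_dom f \<noteq> {}"
  shows "minimizers E f u = opt E (eff_dom f) (val f) u"
proof -
  have fin: "f x - ereal p = ereal (val f x - p)" if "x \<in> eff_dom f" for x p
    using ereal_eq_val[OF assms(1) that] by simp
  have inf: "f x - ereal p = \<infinity>" if "x \<notin> eff_dom f" for x p
    using that by (simp add: eff_dom_def)
  obtain x0 where x0: "x0 \<in> eff_dom f" using assms(3) by blast
  show ?thesis
  proof (intro equalityI subsetI)
    fix x assume "x \<in> minimizers E f u"
    then have *: "\<And>z. z \<in> lattice_vecs E \<Longrightarrow>
        f x - ereal (pairing E u x) \<le> f z - ereal (pairing E u z)"
      unfolding minimizers_def is_arg_min_def by (auto simp: not_less)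
    have x: "x \<in> eff_dom f"
      using *[of x0] x0 assms(2) inf[of x] fin[OF x0] by force
    have "val f x - pairing E u x \<le> val f z - pairing E u z" if "z \<in> eff_dom f" for z
      using *[of z] that assms(2) fin[OF x] fin[OF that] by auto
    then show "x \<in> opt E (eff_dom f) (val f) u"
      using x by (simp add: opt_def)
  next
    fix x assume x: "x \<in> opt E (eff_dom f) (val f) u"
    then have xd: "x \<in> eff_dom f" by (simp add: opt_def)
    have "f x - ereal (pairing E u x) \<le> f z - ereal (pairing E u z)" for z
      using x fin inf xd by (cases "z \<in> eff_dom f") (auto simp: opt_def)
    then show "x \<in> minimizers E f u"
      using xd assms(2) unfolding minimizers_def is_arg_min_def by (auto simp: not_less)
  qed
qed

lemma opt_nonempty:
  assumes "finite S" "S \<noteq> {}"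
  shows "opt E S \<phi> u \<noteq> {}"
proof -
  let ?F = "\<lambda>x. \<phi> x - pairing E u x"
  have "Min (?F ` S) \<in> ?F ` S" using assms by (intro Min_in) auto
  then obtain x where "x \<in> S" "?F x = Min (?F ` S)" by force
  then have "x \<in> opt E S \<phi> u" using assms(1) by (auto simp: opt_def)
  then show ?thesis by blast
qed

section \<open>Each condition gives the exchange between adjacent layers\<close>

text \<open>
As the ranks differ by one, the given M\<open>\<^sup>\<natural>\<close>-convex function has only the layers \<open>f\<close> and \<open>g\<close>, and
its exchange property for a pair from different layers is the conclusion.
\<close>

lemma adjacent_exchange_if_cond_A:
  assumes "finite E" "M_convex E f" "M_convex E g" "rk E f = rk E g + 1" "cond_A E f g"
  shows "adjacent_exchange (eff_dom f) (val f) (eff_dom g) (val g)"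
  unfolding adjacent_exchange_def
proof (intro ballI)
  fix x y assume xy: "x \<in> eff_dom f" "y \<in> eff_dom g"
  note F = M_convex_properties[OF assms(1,2)] and G = M_convex_properties[OF assms(1,3)]
  obtain h k l where h: "Mnat_convex E h" "f = layer_at E h k" "g = layer_at E h l"
    using assms(5) by (auto simp: cond_A_def top_layer_def bottom_layer_def)
  have xk: "coord_sum E x = k" "f x = h x" "coord_sum E y = l" "g y = h y"
    using xy by (auto simp: h(2,3) layer_at_def eff_dom_def split: if_splits)
  have kl: "k = l + 1" using F(5)[OF xy(1)] G(5)[OF xy(2)] xk assms(4) by simp
  have "x \<in> eff_dom h" "y \<in> eff_dom h" using xy xk by (auto simp: eff_dom_def)
  then obtain j where j: "j \<in> E" "y j < x j" "h (x - unit_vec j) + h (y + unit_vec j) \<le> h x + h y"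
    using Mnat_convex_descend[OF assms(1) h(1)] xk kl by (metis zless_add1_eq)
  have "g (x - unit_vec j) + f (y + unit_vec j) \<le> f x + g y"
    using j assms(1) xk kl by (simp add: h(2,3) layer_at_def coord_sum_simps)
  then have "f (y + unit_vec j) + g (x - unit_vec j) \<le> f x + g y" by (simp add: add.commute)
  then show "\<exists>j. y j < x j \<and> x - unit_vec j \<in> eff_dom g \<and> y + unit_vec j \<in> eff_dom f \<and>
      val g (x - unit_vec j) + val f (y + unit_vec j) \<le> val f x + val g y"
    using val_le_if_sum_le[of f, OF F(1) F(1) G(1) G(1) xy] j(2) by (metis add.commute)
qed

lemma local_exchange_if_cond_C:
  assumes "finite E" "M_convex E f" "M_convex E g" "cond_C E f g"
  shows "local_exchange (eff_dom f) (val f) (eff_dom g) (val g)"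
  unfolding local_exchange_def
proof (intro ballI allI impI)
  note F = M_convex_properties[OF assms(1,2)] and G = M_convex_properties[OF assms(1,3)]
  fix x and a b c :: 'a
  let ?y = "x - unit_vec a - unit_vec b + unit_vec c"
  assume x: "x \<in> eff_dom f" and abc: "c \<noteq> a \<and> c \<noteq> b \<and> ?y \<in> eff_dom g"
  then have y: "?y \<in> eff_dom g" by blast
  have lt: "x c < ?y c" using abc by (simp add: unit_vec_def)
  have "{x, ?y} \<subseteq> lattice_vecs E" using F(2) G(2) x abc by auto
  then have "c \<in> E" using support_in_lattice[of "{x, ?y}" E x ?y c] lt by simp
  then have "c \<in> supp_pos E ?y x" using lt by (simp add: supp_pos_def)
  then obtain j where j: "j \<in> supp_neg E ?y x"
    "f (x + unit_vec c - unit_vec j) + g (?y - unit_vec c + unit_vec j) \<le> f x + g ?y"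
    using assms(4)[unfolded cond_C_def, THEN bspec, OF x, THEN bspec, OF y, THEN bspec] by blast
  have jab: "j \<in> {a, b}"
    using j(1) by (auto simp: supp_neg_def supp_pos_def unit_vec_def split: if_splits)
  have eqs: "x + unit_vec c - unit_vec j = x - unit_vec j + unit_vec c"
    "?y - unit_vec c + unit_vec j = x - unit_vec a - unit_vec b + unit_vec j" by simp_all
  note val_le_if_sum_le[of f x "x - unit_vec j + unit_vec c" g ?y
      "x - unit_vec a - unit_vec b + unit_vec j", OF F(1) F(1) G(1) G(1) x y j(2)[unfolded eqs]]
  with jab show "\<exists>p\<in>{a, b}. x - unit_vec p + unit_vec c \<in> eff_dom f \<and>
        x - unit_vec a - unit_vec b + unit_vec p \<in> eff_dom g \<and>
        val f (x - unit_vec p + unit_vec c) + val g (x - unit_vec a - unit_vec b + unit_vec p)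
          \<le> val f x + val g ?y"
    by blast
qed

text \<open>
For \<open>X = {}\<close>, condition (D) says that every minimizer of \<open>g - u\<close> satisfies the rank inequalities of
the minimizers of \<open>f - u\<close>. It is therefore dominated by one of these, which can only be one unit
vector larger.
\<close>

lemma lifts_minimizers_if_cond_D:
  assumes "finite E" "M_convex E f" "M_convex E g" "rk E f = rk E g + 1" "cond_D E f g"
  shows "lifts_minimizers E (eff_dom g) (val g) (eff_dom f) (val f)"
  unfolding lifts_minimizers_def
proof (intro allI ballI)
  fix u y assume y: "y \<in> opt E (eff_dom g) (val g) u"
  note F = M_convex_properties[OF assms(1,2)] and G = M_convex_properties[OF assms(1,3)]
  let ?P = "opt E (eff_dom f) (val f) u" and ?Q = "opt E (eff_dom g) (val g) u"
  have P: "?P \<subseteq> eff_dom f" and Q: "?Q \<subseteq> eff_dom g" by (auto simp: opt_def)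
  have fin: "finite ?P" "finite ?Q" using P Q F(4) G(4) finite_subset by blast+
  have ne: "?P \<noteq> {}" "?Q \<noteq> {}" using opt_nonempty F(3,4) G(3,4) by blast+
  have "\<exists>x\<in>?P. coord_sum A y \<le> coord_sum A x" if A: "A \<subseteq> E" for A
  proof -
    have "max_coord_sum ?Q A - max_coord_sum ?Q {} \<le> max_coord_sum ?P A - max_coord_sum ?P {}"
      using assms(5) A unfolding cond_D_def minimizers_eq_opt[OF F(1,2,3)]
        minimizers_eq_opt[OF G(1,2,3)] by blast
    moreover have "max_coord_sum R {} = 0" if "R \<noteq> {}" for R :: "('a \<Rightarrow> int) set"
      using that by (simp add: max_coord_sum_def coord_sum_def image_constant_conv)
    ultimately have "max_coord_sum ?Q A \<le> max_coord_sum ?P A" using ne by simp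
    moreover have "coord_sum A y \<le> max_coord_sum ?Q A"
      using y fin by (simp add: max_coord_sum_def)
    moreover have "max_coord_sum ?P A \<in> coord_sum A ` ?P"
      unfolding max_coord_sum_def using fin ne by (intro Max_in) auto
    ultimately show ?thesis by (metis imageE order_trans)
  qed
  then obtain x where x: "x \<in> ?P" "\<forall>i\<in>E. y i \<le> x i"
    using dominating_base[OF assms(1) _ M_exchange_opt[OF assms(1) F(2,6)], of u y] P F(2) by auto
  have "x \<in> eff_dom f" "y \<in> eff_dom g" using x(1) y P Q by auto
  then have "\<exists>j\<in>E. x = y + unit_vec j"
    by (intro unit_step[OF assms(1)]) (use assms(4) x(2) F(2,5) G(2,5) in auto)
  then show "\<exists>j\<in>E. y + unit_vec j \<in> ?P" using x(1) by auto
qed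

lemma INF_attained:
  fixes F :: "'b \<Rightarrow> ereal"
  assumes "finite {y \<in> A. F y < \<infinity>}" "(INF y\<in>A. F y) < \<infinity>"
  shows "\<exists>y\<in>A. (INF y\<in>A. F y) = F y"
proof -
  let ?T = "{y \<in> A. F y < \<infinity>}"
  have "?T \<noteq> {}" using assms(2) unfolding INF_less_iff by blast
  then have "Min (F ` ?T) \<in> F ` ?T" using assms(1) by (intro Min_in) auto
  then obtain y where y: "y \<in> ?T" "F y = Min (F ` ?T)" by force
  have "F y \<le> F z" if "z \<in> A" for z
    using that y(2) assms(1) by (cases "F z < \<infinity>") auto
  then have "(INF y\<in>A. F y) = F y"
    using y(1) by (intro antisym INF_lower INF_greatest) auto
  then show ?thesis using y(1) by blast
qed

lemma projection_attained:
  assumes "finite (eff_dom \<gamma>)" "projection E' \<gamma> x < \<infinity>"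
  shows "\<exists>y\<in>lattice_vecs E'. projection E' \<gamma> x = \<gamma> (case_sum x y)"
  unfolding projection_def
proof (rule INF_attained)
  have "{y \<in> lattice_vecs E'. \<gamma> (case_sum x y) < \<infinity>} \<subseteq> (\<lambda>z. z \<circ> Inr) ` eff_dom \<gamma>"
    by (force simp: eff_dom_def image_iff)
  then show "finite {y \<in> lattice_vecs E'. \<gamma> (case_sum x y) < \<infinity>}"
    using assms(1) finite_surj by blast
  show "(INF y\<in>lattice_vecs E'. \<gamma> (case_sum x y)) < \<infinity>"
    using assms(2) by (simp add: projection_def)
qed

lemma projection_le: "y \<in> lattice_vecs E' \<Longrightarrow> projection E' \<gamma> x \<le> \<gamma> (case_sum x y)"
  unfolding projection_def by (rule INF_lower)

lemma case_sum_lattice_vecs: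
  "case_sum x y \<in> lattice_vecs (E <+> E') \<longleftrightarrow> x \<in> lattice_vecs E \<and> y \<in> lattice_vecs E'"
  by (auto simp: lattice_vecs_def split_sum_all)

lemma case_sum_unit_vec:
  "case_sum x y + unit_vec (Inl i) = case_sum (x + unit_vec i) y"
  "case_sum x y - unit_vec (Inl i) = case_sum (x - unit_vec i) y"
  "case_sum x y + unit_vec (Inr j) = case_sum x (y + unit_vec j)"
  "case_sum x y - unit_vec (Inr j) = case_sum x (y - unit_vec j)"
  by (auto simp: fun_eq_iff unit_vec_def split: sum.split)

text \<open>
Represent \<open>f x = \<gamma> (x, y)\<close> and \<open>g z = \<gamma> (z, - y') + r y'\<close> by points where the infima are attained,
and exchange \<open>(z, - y')\<close> with \<open>(x, y)\<close> at \<open>i\<close>. If the answer is an index of \<open>E\<close>, the exchanged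
points witness (C). It cannot be an index of \<open>E'\<close>, since then \<open>x + e\<^sub>i\<close> would lie in the domain of the
projection of \<open>\<gamma>\<close>, above its top layer.
\<close>

lemma cond_C_if_cond_B:
  assumes "finite E" "M_convex E f" "M_convex E g" "cond_B E f g"
  shows "cond_C E f g"
  unfolding cond_C_def
proof (intro ballI)
  note F = M_convex_properties[OF assms(1,2)] and G = M_convex_properties[OF assms(1,3)]
  fix x z i assume x: "x \<in> eff_dom f" and z: "z \<in> eff_dom g" and i: "i \<in> supp_pos E z x"
  obtain E' :: "nat set" and \<gamma> r where E': "finite E'" "M_convex (E <+> E') \<gamma>" "M_convex E' r"
    "f = top_layer E (projection E' \<gamma>)"
    "\<And>x. x \<in> lattice_vecs E \<Longrightarrow> g x = (INF y\<in>lattice_vecs E'. \<gamma> (case_sum x (- y)) + r y)"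
    using assms(4) unfolding cond_B_def by blast
  have fin: "finite (E <+> E')" using assms(1) E'(1) by simp
  note \<Gamma> = M_convex_properties[OF fin E'(2)] and R = M_convex_properties[OF E'(1,3)]
  let ?\<pi> = "projection E' \<gamma>"
  define K where "K = Max (coord_sum E ` eff_dom ?\<pi>)"
  have f_eq: "f w = (if coord_sum E w = K then ?\<pi> w else \<infinity>)" for w
    by (simp add: E'(4) top_layer_def layer_at_def K_def)
  have "eff_dom ?\<pi> \<subseteq> (\<lambda>z. z \<circ> Inl) ` eff_dom \<gamma>"
  proof
    fix w assume "w \<in> eff_dom ?\<pi>"
    then obtain y where "case_sum w y \<in> eff_dom \<gamma>"
      using projection_attained[OF \<Gamma>(4), of E' w] by (auto simp: eff_dom_def)
    then show "w \<in> (\<lambda>z. z \<circ> Inl) ` eff_dom \<gamma>" by (force simp: image_iff)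
  qed
  then have "finite (eff_dom ?\<pi>)" using \<Gamma>(4) finite_surj by blast
  then have K_max: "coord_sum E w \<le> K" if "w \<in> eff_dom ?\<pi>" for w
    using that by (simp add: K_def)
  have xK: "coord_sum E x = K" "f x = ?\<pi> x" "?\<pi> x < \<infinity>"
    using x by (auto simp: eff_dom_def f_eq split: if_splits)
  obtain y where y: "y \<in> lattice_vecs E'" "?\<pi> x = \<gamma> (case_sum x y)"
    using projection_attained[OF \<Gamma>(4) xK(3)] by blast
  have zE: "z \<in> lattice_vecs E" using G(2) z by blast
  let ?F = "\<lambda>y. \<gamma> (case_sum z (- y)) + r y"
  have F_fin: "y \<in> eff_dom r" "case_sum z (- y) \<in> eff_dom \<gamma>" if "?F y < \<infinity>" for y
    using that \<Gamma>(1)[of "case_sum z (- y)"] R(1)[of y]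
    by (auto simp: eff_dom_def less_le)
  have "finite {y \<in> lattice_vecs E'. ?F y < \<infinity>}"
    using R(4) by (rule rev_finite_subset) (use F_fin(1) in blast)
  then obtain y' where y': "y' \<in> lattice_vecs E'" "g z = ?F y'"
    using INF_attained[of "lattice_vecs E'" ?F] E'(5)[OF zE] z by (auto simp: eff_dom_def)
  have F_y': "?F y' < \<infinity>" using z y'(2) by (simp add: eff_dom_def)
  let ?a = "case_sum z (- y')" and ?b = "case_sum x y"
  have ab: "?a \<in> eff_dom \<gamma>" "?b \<in> eff_dom \<gamma>"
    using F_fin(2)[OF F_y'] xK(3) y(2) by (auto simp: eff_dom_def)
  have "?b (Inl i) < ?a (Inl i)" and iE: "i \<in> E" using i by (auto simp: supp_pos_def)
  then obtain k where k: "?a k < ?b k" "?a - unit_vec (Inl i) + unit_vec k \<in> eff_dom \<gamma>"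
    "?b + unit_vec (Inl i) - unit_vec k \<in> eff_dom \<gamma>"
    "val \<gamma> (?a - unit_vec (Inl i) + unit_vec k) + val \<gamma> (?b + unit_vec (Inl i) - unit_vec k)
      \<le> val \<gamma> ?a + val \<gamma> ?b"
    using M_exchangeE[OF \<Gamma>(6) ab] by metis
  have lat: "?b + unit_vec (Inl i) - unit_vec k \<in> lattice_vecs (E <+> E')"
    "?a - unit_vec (Inl i) + unit_vec k \<in> lattice_vecs (E <+> E')"
    using k(2,3) \<Gamma>(2) by auto
  show "\<exists>j\<in>supp_neg E z x. f (x + unit_vec i - unit_vec j) + g (z - unit_vec i + unit_vec j)
      \<le> f x + g z"
  proof (cases k)
    case (Inl j)
    have b': "?b + unit_vec (Inl i) - unit_vec k = case_sum (x + unit_vec i - unit_vec j) y"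
      and a': "?a - unit_vec (Inl i) + unit_vec k = case_sum (z - unit_vec i + unit_vec j) (- y')"
      by (simp_all only: Inl case_sum_unit_vec)
    have "{x, z} \<subseteq> lattice_vecs E" using F(2) x zE by auto
    then have j: "j \<in> E" "z j < x j"
      using support_in_lattice[of "{x, z}" E z x j] k(1) by (auto simp: Inl)
    have "coord_sum E (x + unit_vec i - unit_vec j) = K"
      using xK(1) iE j(1) assms(1) by (simp add: coord_sum_simps)
    then have f': "f (x + unit_vec i - unit_vec j) \<le> \<gamma> (?b + unit_vec (Inl i) - unit_vec k)"
      using projection_le[OF y(1)] unfolding b' by (simp add: f_eq)
    have "z - unit_vec i + unit_vec j \<in> lattice_vecs E"
      using lat(2) unfolding a' case_sum_lattice_vecs by blast
    then have g': "g (z - unit_vec i + unit_vec j)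
        \<le> \<gamma> (?a - unit_vec (Inl i) + unit_vec k) + r y'"
      unfolding a' using E'(5) y'(1) by (auto intro: INF_lower2)
    have "f (x + unit_vec i - unit_vec j) + g (z - unit_vec i + unit_vec j)
        \<le> \<gamma> (?b + unit_vec (Inl i) - unit_vec k) + (\<gamma> (?a - unit_vec (Inl i) + unit_vec k) + r y')"
      using f' g' by (rule add_mono)
    also have "\<dots> = ereal (val \<gamma> (?b + unit_vec (Inl i) - unit_vec k)
        + (val \<gamma> (?a - unit_vec (Inl i) + unit_vec k) + val r y'))"
      using ereal_eq_val[of \<gamma>, OF \<Gamma>(1) k(2)] ereal_eq_val[of \<gamma>, OF \<Gamma>(1) k(3)]
        ereal_eq_val[of r, OF R(1) F_fin(1)[OF F_y']] by simp
    also have "\<dots> \<le> ereal (val \<gamma> ?b + (val \<gamma> ?a + val r y'))"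
      using k(4) by simp
    also have "\<dots> = f x + g z"
      using ereal_eq_val[of \<gamma>, OF \<Gamma>(1) ab(1)] ereal_eq_val[of \<gamma>, OF \<Gamma>(1) ab(2)]
        ereal_eq_val[of r, OF R(1) F_fin(1)[OF F_y']] xK(2) y(2) y'(2) by simp
    finally show ?thesis using j by (auto simp: supp_neg_def supp_pos_def)
  next
    case (Inr j)
    have b': "?b + unit_vec (Inl i) - unit_vec k = case_sum (x + unit_vec i) (y - unit_vec j)"
      by (simp_all only: Inr case_sum_unit_vec)
    then have "y - unit_vec j \<in> lattice_vecs E'"
      using lat(1) unfolding b' case_sum_lattice_vecs by blast
    then have "?\<pi> (x + unit_vec i) < \<infinity>"
      using projection_le[of "y - unit_vec j" E' \<gamma> "x + unit_vec i"] k(3)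
      unfolding b' eff_dom_def by (auto intro: order_le_less_trans)
    then have "coord_sum E (x + unit_vec i) \<le> K" using K_max by (simp add: eff_dom_def)
    then show ?thesis using xK(1) iE assms(1) by (simp add: coord_sum_simps)
  qed
qed

lemma adjacent_exchange_if_conditions:
  assumes E: "finite E" and f: "M_convex E f" and g: "M_convex E g"
    and rk: "rk E f = rk E g + 1"
    and dom: "\<And>x y. x \<in> eff_dom f \<Longrightarrow> y \<in> eff_dom g \<Longrightarrow>
      \<exists>j. y j < x j \<and> x - unit_vec j \<in> eff_dom g \<and> y + unit_vec j \<in> eff_dom f"
    and "cond_A E f g \<or> cond_B E f g \<or> cond_C E f g \<or> cond_D E f g"
  shows "adjacent_exchange (eff_dom f) (val f) (eff_dom g) (val g)"
proof (cases "cond_A E f g")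
  case True
  then show ?thesis using adjacent_exchange_if_cond_A[OF E f g rk] by blast
next
  case False
  note F = M_convex_properties[OF E f] and G = M_convex_properties[OF E g]
  have "local_exchange (eff_dom f) (val f) (eff_dom g) (val g)"
  proof (cases "cond_D E f g")
    case True
    show ?thesis
      by (rule local_exchange_if_lifts_minimizers[OF E F(2,6) G(2,6,5)
            lifts_minimizers_if_cond_D[OF E f g rk True]])
  next
    case False
    then have "cond_C E f g" using \<open>\<not> cond_A E f g\<close> assms(6) cond_C_if_cond_B[OF E f g] by blast
    then show ?thesis by (rule local_exchange_if_cond_C[OF E f g])
  qed
  then show ?thesis
    using adjacent_exchange_if_local[OF E _ F(6) dom] F(2) G(2) by blast
qed

section \<open>Gluing the layers\<close>

lemma Min_le_if_witness: "finite A \<Longrightarrow> j \<in> A \<Longrightarrow> F j \<le> v \<Longrightarrow> Min (F ` A) \<le> v"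
  for F :: "'b \<Rightarrow> 'c::linorder"
  by (meson Min_le finite_imageI imageI order_trans)

theorem theorem1p4:
  fixes E :: "'a set" and k :: nat and f :: "nat \<Rightarrow> ('a \<Rightarrow> int) \<Rightarrow> ereal"
  assumes "finite E"
    and "\<And>i. i \<le> k \<Longrightarrow> M_convex E (f i)"
    and "\<And>i. i \<in> {1..k} \<Longrightarrow> rk E (f i) = rk E (f (i - 1)) + 1"
    and "\<And>i. i \<in> {1..k} \<Longrightarrow>
           cond_A E (f i) (f (i - 1)) \<or> cond_B E (f i) (f (i - 1)) \<or>
           cond_C E (f i) (f (i - 1)) \<or> cond_D E (f i) (f (i - 1))"
    and "Mnat_convex_set E (\<Union>i\<le>k. eff_dom (f i))"
  shows "\<exists>c :: nat \<Rightarrow> real. \<exists>h :: ('a \<Rightarrow> int) \<Rightarrow> ereal.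
           h = (\<lambda>x. INF i\<in>{..k}. f i x - ereal (c i)) \<and>
           Mnat_convex E h \<and>
           layers E h = (\<lambda>i x. f i x - ereal (c i)) ` {..k}"
proof -
  note F = M_convex_properties[OF assms(1,2)]
  define P where "P = (\<Union>i\<le>k. eff_dom (f i))"
  define R where "R = rk E (f 0)"
  have rank: "rk E (f i) = R + int i" if "i \<le> k" for i
    using that
  proof (induction i)
    case (Suc i)
    then show ?case using assms(3)[of "Suc i"] by simp
  qed (simp add: R_def)
  have sum: "coord_sum E x = R + int i" if "i \<le> k" "x \<in> eff_dom (f i)" for i x
    using F(5)[OF that] rank[OF that(1)] by simp
  have in_layer: "x \<in> eff_dom (f i)" if "x \<in> P" "coord_sum E x = R + int i" for i x
    using that sum by (auto simp: P_def)
  have P_descend: "\<exists>j\<in>supp_pos E x y. x - unit_vec j \<in> eff_dom (f (i - 1)) \<and>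
      y + unit_vec j \<in> eff_dom (f (Suc l))"
    if "i \<le> k" "l < i" "x \<in> eff_dom (f i)" "y \<in> eff_dom (f l)" for i l x y
  proof -
    have "x \<in> P" "y \<in> P" "coord_sum E y < coord_sum E x"
      using that sum[of i x] sum[of l y] by (auto simp: P_def)
    then obtain j where j: "j \<in> supp_pos E x y" "x - unit_vec j \<in> P" "y + unit_vec j \<in> P"
      using assms(5) unfolding Mnat_convex_set_def P_def by blast
    have "j \<in> E" using j(1) by (simp add: supp_pos_def)
    then have "coord_sum E (x - unit_vec j) = R + int (i - 1)"
      "coord_sum E (y + unit_vec j) = R + int (Suc l)"
      using that sum[of i x] sum[of l y] assms(1) by (auto simp: coord_sum_simps)
    then show ?thesis using in_layer j by blast
  qed
  have adjacent: "adjacent_exchange (eff_dom (f (Suc l))) (val (f (Suc l)))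
      (eff_dom (f l)) (val (f l))"
    if l: "Suc l \<le> k" for l
  proof (rule adjacent_exchange_if_conditions[OF assms(1)])
    show "M_convex E (f (Suc l))" "M_convex E (f l)" using assms(2) l by auto
    show "rk E (f (Suc l)) = rk E (f l) + 1" using rank l by simp
    show "cond_A E (f (Suc l)) (f l) \<or> cond_B E (f (Suc l)) (f l) \<or>
        cond_C E (f (Suc l)) (f l) \<or> cond_D E (f (Suc l)) (f l)"
      using assms(4)[of "Suc l"] l by simp
    fix x y assume "x \<in> eff_dom (f (Suc l))" "y \<in> eff_dom (f l)"
    then show "\<exists>j. y j < x j \<and> x - unit_vec j \<in> eff_dom (f l) \<and>
        y + unit_vec j \<in> eff_dom (f (Suc l))"
      using P_descend[OF l, of l x y] by (auto simp: supp_pos_def)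
  qed
  define M where "M = 2 * (\<Sum>i\<le>k. \<Sum>x\<in>eff_dom (f i). \<bar>val (f i) x\<bar>)"
  have M: "2 * \<bar>val (f i) x\<bar> \<le> M" if "i \<le> k" "x \<in> eff_dom (f i)" for i x
  proof -
    have "\<bar>val (f i) x\<bar> \<le> (\<Sum>x\<in>eff_dom (f i). \<bar>val (f i) x\<bar>)"
      using F(4)[OF that(1)] that(2) by (intro member_le_sum) auto
    also have "\<dots> \<le> (\<Sum>i\<le>k. \<Sum>x\<in>eff_dom (f i). \<bar>val (f i) x\<bar>)"
      using that(1) by (intro member_le_sum[of i "{..k}" "\<lambda>i. \<Sum>x\<in>eff_dom (f i). \<bar>val (f i) x\<bar>"])
        (auto intro: sum_nonneg)
    finally show ?thesis by (simp add: M_def)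
  qed
  define c where "c i = - M * (real i)\<^sup>2" for i :: nat
  define h where "h x = (INF i\<in>{..k}. f i x - ereal (c i))" for x
  have h_layer: "h x = ereal (val (f i) x - c i)" if i: "i \<le> k" "x \<in> eff_dom (f i)" for i x
  proof -
    have fin: "f i x - ereal (c i) = ereal (val (f i) x - c i)"
      using ereal_eq_val[of "f i", OF F(1)[OF i(1)] i(2)] by simp
    have "f i x - ereal (c i) \<le> f l x - ereal (c l)" if "l \<le> k" for l
    proof (cases "l = i")
      case False
      then have "x \<notin> eff_dom (f l)" using sum[OF that] sum[OF i] by fastforce
      then show ?thesis by (simp add: eff_dom_def)
    qed simp
    then have "h x = f i x - ereal (c i)"
      unfolding h_def using i(1) by (intro antisym INF_lower INF_greatest) auto
    then show ?thesis using fin by simp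
  qed
  have h_outside: "h x = \<infinity>" if "x \<notin> P" for x
  proof -
    have "f i x - ereal (c i) = \<infinity>" if "i \<le> k" for i
      using that \<open>x \<notin> P\<close> by (auto simp: P_def eff_dom_def)
    then have "\<infinity> \<le> h x" unfolding h_def by (intro INF_greatest) auto
    then show ?thesis by simp
  qed
  have dom_h: "eff_dom h = P"
    using h_outside h_layer by (force simp: eff_dom_def P_def)
  have descend: "Min ((\<lambda>j. h (x - unit_vec j) + h (y + unit_vec j)) ` supp_pos E x y) \<le> h x + h y"
    if xy: "x \<in> P" "y \<in> P" "coord_sum E y < coord_sum E x" for x y
  proof -
    obtain i l where i: "i \<le> k" "x \<in> eff_dom (f i)" and l: "l \<le> k" "y \<in> eff_dom (f l)"
      using xy by (auto simp: P_def)
    have li: "l < i" using xy(3) sum[OF i] sum[OF l] by simp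
    have "\<exists>j\<in>supp_pos E x y. h (x - unit_vec j) + h (y + unit_vec j) \<le> h x + h y"
    proof (cases "i = Suc l")
      case True
      obtain j where j: "y j < x j" "x - unit_vec j \<in> eff_dom (f l)" "y + unit_vec j \<in> eff_dom (f i)"
        "val (f l) (x - unit_vec j) + val (f i) (y + unit_vec j) \<le> val (f i) x + val (f l) y"
        using adjacent[of l] i l unfolding True adjacent_exchange_def by blast
      have "{x, y} \<subseteq> lattice_vecs E" using F(2)[OF i(1)] F(2)[OF l(1)] i l by auto
      then have "j \<in> E" using support_in_lattice[of "{x, y}" E y x j] j(1) by simp
      then show ?thesis
        using j h_layer[OF i] h_layer[OF l] h_layer[OF i(1) j(3)] h_layer[OF l(1) j(2)]
        by (intro bexI[of _ j]) (auto simp: supp_pos_def)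
    next
      case False
      obtain j where j: "j \<in> supp_pos E x y" "x - unit_vec j \<in> eff_dom (f (i - 1))"
        "y + unit_vec j \<in> eff_dom (f (Suc l))"
        using P_descend[OF i(1) li i(2) l(2)] by blast
      have il: "i - 1 \<le> k" "Suc l \<le> k" using i(1) li by auto
      \<comment> \<open>The sum of the shifts falls by \<open>2 M (i - l - 1)\<close>, that of the values grows by at most \<open>2 M\<close>.\<close>
      have "0 \<le> M" using M[OF i] by linarith
      moreover have "1 \<le> real i - real l - 1" using li False by linarith
      ultimately have "2 * M * 1 \<le> 2 * M * (real i - real l - 1)"
        by (intro mult_left_mono) auto
      then have "c (i - 1) + c (Suc l) - c i - c l \<ge> 2 * M"
        using li by (simp add: c_def of_nat_diff power2_eq_square algebra_simps)
      moreover have "val (f (i - 1)) (x - unit_vec j) + val (f (Suc l)) (y + unit_vec j)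
          - val (f i) x - val (f l) y \<le> 2 * M"
        using M[OF i] M[OF l] M[OF il(1) j(2)] M[OF il(2) j(3)] by linarith
      ultimately have "h (x - unit_vec j) + h (y + unit_vec j) \<le> h x + h y"
        using h_layer[OF i] h_layer[OF l] h_layer[OF il(1) j(2)] h_layer[OF il(2) j(3)] by simp
      then show ?thesis using j(1) by blast
    qed
    moreover have "finite (supp_pos E x y)" using assms(1) by (simp add: supp_pos_def)
    ultimately show ?thesis
      using Min_le_if_witness[where F = "\<lambda>j. h (x - unit_vec j) + h (y + unit_vec j)"] by blast
  qed
  have exchange: "Min ((\<lambda>j. h (x - unit_vec p + unit_vec j) + h (y + unit_vec p - unit_vec j))
        ` supp_neg E x y) \<le> h x + h y"
    if xy: "x \<in> P" "y \<in> P" "coord_sum E x = coord_sum E y" and p: "p \<in> supp_pos E x y" for x y p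
  proof -
    obtain i where i: "i \<le> k" "x \<in> eff_dom (f i)" using xy(1) by (auto simp: P_def)
    have iy: "y \<in> eff_dom (f i)" using in_layer[OF xy(2)] xy(3) sum[OF i] by simp
    have "y p < x p" using p by (simp add: supp_pos_def)
    then obtain j where j: "x j < y j" "x - unit_vec p + unit_vec j \<in> eff_dom (f i)"
      "y + unit_vec p - unit_vec j \<in> eff_dom (f i)"
      "val (f i) (x - unit_vec p + unit_vec j) + val (f i) (y + unit_vec p - unit_vec j)
        \<le> val (f i) x + val (f i) y"
      using M_exchangeE[OF F(6)[OF i(1)] i(2) iy] by metis
    have "j \<in> E" using support_in_lattice[OF F(2)[OF i(1)] i(2) iy j(1)] .
    then have "j \<in> supp_neg E x y" using j(1) by (simp add: supp_neg_def supp_pos_def)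
    moreover have "h (x - unit_vec p + unit_vec j) + h (y + unit_vec p - unit_vec j) \<le> h x + h y"
      using j(4) h_layer[OF i] h_layer[OF i(1) iy] h_layer[OF i(1) j(2)] h_layer[OF i(1) j(3)]
      by simp
    moreover have "finite (supp_neg E x y)" using assms(1) by (simp add: supp_neg_def supp_pos_def)
    ultimately show ?thesis
      using Min_le_if_witness[where
          F = "\<lambda>j. h (x - unit_vec p + unit_vec j) + h (y + unit_vec p - unit_vec j)"] by blast
  qed
  have "h x \<noteq> -\<infinity>" for x
  proof (cases "x \<in> P")
    case True
    then show ?thesis using h_layer by (auto simp: P_def)
  qed (simp add: h_outside)
  then have "Mnat_convex E h"
    using assms(5) descend exchange
    unfolding Mnat_convex_def dom_h Mnat_convex_set_def P_def[symmetric] by blast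
  moreover have layer: "layer_at E h (R + int i) = (\<lambda>x. f i x - ereal (c i))" if "i \<le> k" for i
  proof
    fix x
    show "layer_at E h (R + int i) x = f i x - ereal (c i)"
    proof (cases "x \<in> eff_dom (f i)")
      case True
      then show ?thesis
        using sum[OF that True] h_layer[OF that True] ereal_eq_val[of "f i", OF F(1)[OF that] True]
        by (simp add: layer_at_def)
    next
      case False
      then have "coord_sum E x = R + int i \<longrightarrow> h x = \<infinity>" using in_layer h_outside by blast
      then show ?thesis using False by (simp add: layer_at_def eff_dom_def)
    qed
  qed
  moreover have "coord_sum E ` eff_dom h = (\<lambda>i. R + int i) ` {..k}"
  proof (intro equalityI subsetI)
    fix r assume "r \<in> (\<lambda>i. R + int i) ` {..k}"
    then obtain i where i: "i \<le> k" "r = R + int i" by auto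
    then obtain x where "x \<in> eff_dom (f i)" using F(3)[OF i(1)] by blast
    then show "r \<in> coord_sum E ` eff_dom h"
      using sum[OF i(1)] i unfolding dom_h P_def by force
  qed (use sum in \<open>auto simp: dom_h P_def\<close>)
  ultimately have "layers E h = (\<lambda>i x. f i x - ereal (c i)) ` {..k}"
    unfolding layers_def by (force simp: image_image)
  with \<open>Mnat_convex E h\<close> show ?thesis
    using h_def by blast
qed

end
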